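(* Let $1\le p<\infty$ and assume: (A) $(X,\mathfrak{B}_X,\lambda)$ is a finite dimensional Banach space with a Haar measure $\lambda$ defined on the $\sigma$-algebra $\mathfrak{B}_X$ of Borel subsets of $X$; (B) $Y$ is a compact metric space, and $y_0\in Y$; (C) $\mathcal{F}\subset L_p(X,\mathcal{Q}_Q(Y))$ is a family such that: (i) $\sup\{\|f\|_{L_p}:f\in\mathcal{F}\}<\infty$; (ii) for every $\varepsilon>0$ there exists a neighbourhood $U$ of $0$ in $X$ such that $\sup\{d_p(\tau_hf,f):f\in\mathcal{F}\}<\varepsilon$ whenever $h\in U$, where $(\tau_hf)(x)=f(x+h)$; (iii) for every $\varepsilon>0$ there exists a compact $K\subset X$ such that $\sup\{d_p(f,f_K):f\in\mathcal{F}\}<\varepsilon$, where $f_K(x)=f(x)$ if $x\in K$ and $f_K(x)=Q[\![y_0]\!]$ if $x\notin K$. Then $\mathcal{F}$ is relatively compact in $L_p(X,\mathcal{Q}_Q(Y))$ equipped with the semimetric $d_p$.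
   Context: $Q\ge1$ is an integer. $\mathcal{Q}_Q(Y)$ is the quotient of $Y^Q$ by the permutation action of $S_Q$; the class of $(y_1,\dots,y_Q)$ is $[\![y_1,\dots,y_Q]\!]$, and $Q[\![y_0]\!]=[\![y_0,\dots,y_0]\!]$. It carries the metric $\mathcal{G}_2([\![y_1,\dots,y_Q]\!],[\![y_1',\dots,y_Q']\!])=\min_{\sigma\in S_Q}\big(\sum_i d(y_i,y'_{\sigma(i)})^2\big)^{1/2}$. $L_p(X,\mathcal{Q}_Q(Y))$ is the collection of Borel measurable maps $f:X\to\mathcal{Q}_Q(Y)$ such that $x\mapsto\mathcal{G}_2(f(x),Q[\![y_0]\!])^p$ is $\lambda$-summable; $\|f\|_{L_p}=\big(\int_X\mathcal{G}_2(f,Q[\![y_0]\!])^pd\lambda\big)^{1/p}$ and $d_p(f,g)=\big(\int_X\mathcal{G}_2(f,g)^pd\lambda\big)^{1/p}$, a semimetric. *)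

theory Defs
  imports "HOL-Analysis.Analysis"
begin

section \<open>Unordered tuples of points of a metric space\<close>

text \<open>The number \<open>Q \<ge> 1\<close> of points is the cardinality of the index type \<open>'q\<close>, so that \<open>'b ^ 'q\<close>
  is the \<open>Q\<close>-fold product of \<open>'b\<close>, and quantifying over \<open>'q\<close> quantifies over all \<open>Q \<ge> 1\<close>.\<close>

definition perm_rel :: "'b ^ 'q \<Rightarrow> 'b ^ 'q \<Rightarrow> bool" where
  "perm_rel y z \<longleftrightarrow> (\<exists>\<sigma>. \<sigma> permutes UNIV \<and> z = (\<chi> i. y $ \<sigma> i))"

lemma equivp_perm_rel: "equivp (perm_rel :: 'b ^ 'q \<Rightarrow> _)"
proof (rule equivpI)
  show "reflp (perm_rel :: 'b ^ 'q \<Rightarrow> _)"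
  proof (rule reflpI)
    fix y :: "'b ^ 'q"
    have "id permutes (UNIV :: 'q set)" "y = (\<chi> i. y $ id i)"
      by (rule permutes_id) simp
    then show "perm_rel y y" unfolding perm_rel_def by blast
  qed
  show "symp (perm_rel :: 'b ^ 'q \<Rightarrow> _)"
  proof (rule sympI)
    fix y z :: "'b ^ 'q" assume "perm_rel y z"
    then obtain \<sigma> where s: "\<sigma> permutes UNIV" "z = (\<chi> i. y $ \<sigma> i)"
      unfolding perm_rel_def by blast
    then show "perm_rel z y"
      unfolding perm_rel_def
      by (intro exI[of _ "inv \<sigma>"]) (auto simp: vec_eq_iff permutes_inv permutes_inverses)
  qed
  show "transp (perm_rel :: 'b ^ 'q \<Rightarrow> _)"
  proof (rule transpI)
    fix x y z :: "'b ^ 'q" assume "perm_rel x y" "perm_rel y z"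
    then obtain \<sigma> \<rho> where "\<sigma> permutes UNIV" "y = (\<chi> i. x $ \<sigma> i)"
      "\<rho> permutes UNIV" "z = (\<chi> i. y $ \<rho> i)"
      unfolding perm_rel_def by blast
    then show "perm_rel x z"
      unfolding perm_rel_def
      by (intro exI[of _ "\<sigma> \<circ> \<rho>"]) (auto simp: vec_eq_iff permutes_compose)
  qed
qed

quotient_type ('b, 'q) unordered = "'b ^ 'q::finite" / perm_rel
  morphisms rep_unordered unordered_class
  by (rule equivp_perm_rel)

definition unordered_const :: "'b \<Rightarrow> ('b, 'q::finite) unordered" where
  "unordered_const y = unordered_class (\<chi> i. y)"

definition G2_rep :: "'b::metric_space ^ 'q \<Rightarrow> 'b ^ 'q \<Rightarrow> real" where
  "G2_rep y z = (MIN \<sigma> \<in> {\<sigma>. \<sigma> permutes (UNIV :: 'q set)}.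
     sqrt (\<Sum>i\<in>UNIV. (dist (y $ i) (z $ \<sigma> i))\<^sup>2))"

lemma finite_perms: "finite {\<sigma>. \<sigma> permutes (UNIV :: 'q::finite set)}"
  by (rule finite_permutations) simp

lemma perms_nonempty: "{\<sigma>. \<sigma> permutes (UNIV :: 'q::finite set)} \<noteq> {}"
  using permutes_id by blast

lemma G2_rep_le:
  fixes y z :: "'b::metric_space ^ 'q"
  assumes "\<sigma> permutes UNIV"
  shows "G2_rep y z \<le> dist y (\<chi> i. z $ \<sigma> i)"
  unfolding G2_rep_def dist_vec_def L2_set_def
  using assms by (intro Min_le) (auto simp: finite_perms)

lemma G2_rep_attained:
  fixes y z :: "'b::metric_space ^ 'q"
  obtains \<sigma> where "\<sigma> permutes UNIV" "G2_rep y z = dist y (\<chi> i. z $ \<sigma> i)"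
proof -
  have "G2_rep y z \<in> (\<lambda>\<sigma>. sqrt (\<Sum>i\<in>UNIV. (dist (y $ i) (z $ \<sigma> i))\<^sup>2)) `
      {\<sigma>. \<sigma> permutes (UNIV :: 'q set)}"
    unfolding G2_rep_def using finite_perms perms_nonempty by (intro Min_in) auto
  then show ?thesis using that by (auto simp: dist_vec_def L2_set_def)
qed

lemma dist_permute:
  fixes y z :: "'b::metric_space ^ 'q"
  assumes "\<sigma> permutes UNIV"
  shows "dist (\<chi> i. y $ \<sigma> i) (\<chi> i. z $ \<sigma> i) = dist y z"
  unfolding dist_vec_def L2_set_def
  using sum.permute[OF assms, of "\<lambda>i. (dist (y $ i) (z $ i))\<^sup>2"] by (simp add: o_def)

lemma G2_rep_sym_le:
  fixes y z :: "'b::metric_space ^ 'q"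
  shows "G2_rep z y \<le> G2_rep y z"
proof -
  obtain \<sigma> where s: "\<sigma> permutes UNIV" "G2_rep y z = dist y (\<chi> i. z $ \<sigma> i)"
    by (rule G2_rep_attained)
  have i: "inv \<sigma> permutes UNIV" using s(1) by (rule permutes_inv)
  have "dist z (\<chi> i. y $ inv \<sigma> i)
      = dist (\<chi> i. y $ inv \<sigma> i) (\<chi> i. (\<chi> j. z $ \<sigma> j) $ inv \<sigma> i)"
    using s(1) by (simp add: permutes_inverses dist_commute)
  also have "\<dots> = dist y (\<chi> i. z $ \<sigma> i)" by (rule dist_permute[OF i])
  finally show ?thesis using G2_rep_le[OF i, of z y] s(2) by simp
qed

lemma G2_rep_sym: "G2_rep z y = G2_rep y z"
  by (intro antisym G2_rep_sym_le)

lemma G2_rep_triangle: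
  fixes x y z :: "'b::metric_space ^ 'q"
  shows "G2_rep x z \<le> G2_rep x y + G2_rep y z"
proof -
  obtain \<sigma> where s: "\<sigma> permutes UNIV" "G2_rep x y = dist x (\<chi> i. y $ \<sigma> i)"
    by (rule G2_rep_attained)
  obtain \<rho> where r: "\<rho> permutes UNIV" "G2_rep y z = dist y (\<chi> i. z $ \<rho> i)"
    by (rule G2_rep_attained)
  have "G2_rep x z \<le> dist x (\<chi> i. z $ (\<rho> \<circ> \<sigma>) i)"
    by (rule G2_rep_le[OF permutes_compose[OF s(1) r(1)]])
  also have "\<dots> \<le> dist x (\<chi> i. y $ \<sigma> i)
      + dist (\<chi> i. y $ \<sigma> i) (\<chi> i. (\<chi> j. z $ \<rho> j) $ \<sigma> i)"
    by (simp add: dist_triangle)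
  also have "\<dots> = G2_rep x y + G2_rep y z"
    unfolding s(2) r(2) dist_permute[OF s(1)] by simp
  finally show ?thesis .
qed

lemma G2_rep_eq_0_iff: "G2_rep y z = 0 \<longleftrightarrow> perm_rel z y"
proof
  assume "G2_rep y z = 0"
  then show "perm_rel z y"
    using G2_rep_attained[of y z] unfolding perm_rel_def by (metis dist_eq_0_iff)
next
  assume "perm_rel z y"
  then obtain \<sigma> where "\<sigma> permutes UNIV" "y = (\<chi> i. z $ \<sigma> i)"
    unfolding perm_rel_def by blast
  then have "G2_rep y z \<le> 0" using G2_rep_le[of \<sigma> y z] by simp
  moreover have "0 \<le> G2_rep y z"
    using G2_rep_attained[of y z] by (metis zero_le_dist)
  ultimately show "G2_rep y z = 0" by simp
qed

lemma G2_rep_cong: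
  assumes "perm_rel y y'" "perm_rel z z'"
  shows "G2_rep y z = G2_rep y' z'"
proof -
  have "G2_rep y' y = 0" "G2_rep z' z = 0"
    using assms by (simp_all add: G2_rep_eq_0_iff)
  then show ?thesis
    using G2_rep_triangle[of y z y'] G2_rep_triangle[of y' z z']
      G2_rep_triangle[of y' z' y] G2_rep_triangle[of y z' z]
      G2_rep_sym[of y y'] G2_rep_sym[of z z'] by linarith
qed

instantiation unordered :: (metric_space, finite) metric_space
begin

lift_definition dist_unordered :: "('a, 'b) unordered \<Rightarrow> ('a, 'b) unordered \<Rightarrow> real" is G2_rep
  by (rule G2_rep_cong)

definition uniformity_unordered :: "(('a, 'b) unordered \<times> ('a, 'b) unordered) filter" where
  "uniformity_unordered = (INF e\<in>{0 <..}. principal {(x, y). dist x y < e})"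

definition open_unordered :: "('a, 'b) unordered set \<Rightarrow> bool" where
  "open_unordered U \<longleftrightarrow> (\<forall>x\<in>U. \<forall>\<^sub>F (x', y) in uniformity. x' = x \<longrightarrow> y \<in> U)"

instance
proof
  fix x y z :: "('a, 'b) unordered"
  show "dist x y = 0 \<longleftrightarrow> x = y"
    by transfer (use equivp_symp[OF equivp_perm_rel] in \<open>auto simp: G2_rep_eq_0_iff\<close>)
  show "dist x y \<le> dist x z + dist y z"
    by transfer (metis G2_rep_triangle G2_rep_sym)
qed (simp_all add: uniformity_unordered_def open_unordered_def)

end


section \<open>Haar measures\<close>

text \<open>Standard definition: a nonzero translation-invariant Radon measure on the Borel sets.\<close>

definition haar_measure :: "'a::real_normed_vector measure \<Rightarrow> bool" where
  "haar_measure M \<longleftrightarrow>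
     sets M = sets borel \<and>
     emeasure M UNIV \<noteq> 0 \<and>
     (\<forall>h. \<forall>A\<in>sets borel. emeasure M ((\<lambda>x. h + x) ` A) = emeasure M A) \<and>
     (\<forall>K. compact K \<longrightarrow> emeasure M K < \<infinity>) \<and>
     (\<forall>A\<in>sets borel. emeasure M A = (INF U\<in>{U. open U \<and> A \<subseteq> U}. emeasure M U)) \<and>
     (\<forall>U. open U \<longrightarrow> emeasure M U = (SUP K\<in>{K. compact K \<and> K \<subseteq> U}. emeasure M K))"


section \<open>The semimetric space \<open>L\<^sub>p\<close>\<close>

definition Lp_maps :: "real \<Rightarrow> 'a::topological_space measure \<Rightarrow> 'b::metric_space
    \<Rightarrow> ('a \<Rightarrow> ('b, 'q::finite) unordered) set" where
  "Lp_maps p M y0 =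
     {f \<in> borel_measurable M. integrable M (\<lambda>x. dist (f x) (unordered_const y0) powr p)}"

text \<open>For \<open>f\<close> and \<open>g\<close> in \<open>Lp_maps p M y0\<close>, with \<open>p \<ge> 1\<close> and \<open>'b\<close> separable, the integrand below is
  integrable by the triangle inequality, so the convention that a divergent Bochner integral is \<open>0\<close> plays no role.\<close>

definition Lp_dist :: "real \<Rightarrow> 'a measure \<Rightarrow> ('a \<Rightarrow> ('b::metric_space, 'q::finite) unordered)
    \<Rightarrow> ('a \<Rightarrow> ('b, 'q) unordered) \<Rightarrow> real" where
  "Lp_dist p M f g = (\<integral>x. dist (f x) (g x) powr p \<partial>M) powr (1 / p)"

definition Lp_norm :: "real \<Rightarrow> 'a measure \<Rightarrow> 'b::metric_space
    \<Rightarrow> ('a \<Rightarrow> ('b, 'q::finite) unordered) \<Rightarrow> real" where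
  "Lp_norm p M y0 f = (\<integral>x. dist (f x) (unordered_const y0) powr p \<partial>M) powr (1 / p)"

text \<open>Maps are not identified almost everywhere, so this is the (in general non-Hausdorff) topology
  of the semimetric.\<close>

definition Lp_topology :: "real \<Rightarrow> 'a::topological_space measure \<Rightarrow> 'b::metric_space
    \<Rightarrow> ('a \<Rightarrow> ('b, 'q::finite) unordered) topology" where
  "Lp_topology p M y0 = topology (\<lambda>U. U \<subseteq> Lp_maps p M y0 \<and>
     (\<forall>f\<in>U. \<exists>r>0. \<forall>g\<in>Lp_maps p M y0. Lp_dist p M f g < r \<longrightarrow> g \<in> U))"

lemma openin_Lp_topology:
  fixes U :: "('a::topological_space \<Rightarrow> ('b::metric_space, 'q::finite) unordered) set"
  shows "openin (Lp_topology p M y0) U \<longleftrightarrow> U \<subseteq> Lp_maps p M y0 \<and>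
     (\<forall>f\<in>U. \<exists>r>0. \<forall>g\<in>Lp_maps p M y0. Lp_dist p M f g < r \<longrightarrow> g \<in> U)"
proof -
  let ?P = "\<lambda>U :: ('a \<Rightarrow> ('b, 'q) unordered) set. U \<subseteq> Lp_maps p M y0 \<and>
     (\<forall>f\<in>U. \<exists>r>0. \<forall>g\<in>Lp_maps p M y0. Lp_dist p M f g < r \<longrightarrow> g \<in> U)"
  have "istopology ?P"
    unfolding istopology_def
  proof (intro conjI allI impI)
    fix S T :: "('a \<Rightarrow> ('b, 'q) unordered) set" assume S: "?P S" and T: "?P T"
    show "S \<inter> T \<subseteq> Lp_maps p M y0" using S by blast
    show "\<forall>f\<in>S \<inter> T. \<exists>r>0. \<forall>g\<in>Lp_maps p M y0. Lp_dist p M f g < r \<longrightarrow> g \<in> S \<inter> T"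
    proof
      fix f assume "f \<in> S \<inter> T"
      then obtain r s where "r > 0" "\<forall>g\<in>Lp_maps p M y0. Lp_dist p M f g < r \<longrightarrow> g \<in> S"
        and "s > 0" "\<forall>g\<in>Lp_maps p M y0. Lp_dist p M f g < s \<longrightarrow> g \<in> T"
        using S T by blast
      then show "\<exists>r>0. \<forall>g\<in>Lp_maps p M y0. Lp_dist p M f g < r \<longrightarrow> g \<in> S \<inter> T"
        by (intro exI[of _ "min r s"]) auto
    qed
  next
    fix \<K> :: "('a \<Rightarrow> ('b, 'q) unordered) set set" assume K: "\<forall>K\<in>\<K>. ?P K"
    show "\<Union>\<K> \<subseteq> Lp_maps p M y0" using K by blast
    show "\<forall>f\<in>\<Union>\<K>. \<exists>r>0. \<forall>g\<in>Lp_maps p M y0. Lp_dist p M f g < r \<longrightarrow> g \<in> \<Union>\<K>"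
      using K by (meson UnionE UnionI)
  qed
  then show ?thesis unfolding Lp_topology_def by (simp add: topology_inverse')
qed

lemma topspace_Lp_topology: "topspace (Lp_topology p M y0) = Lp_maps p M y0"
  unfolding topspace_def openin_Lp_topology
  by (intro equalityI Sup_least Sup_upper CollectI) (auto intro: exI[of _ 1])

definition relatively_compact_in :: "'c topology \<Rightarrow> 'c set \<Rightarrow> bool" where
  "relatively_compact_in T S \<longleftrightarrow> S \<subseteq> topspace T \<and> compactin T (T closure_of S)"


section \<open>Translation and truncation\<close>

definition translate :: "'a::real_normed_vector \<Rightarrow> ('a \<Rightarrow> 'c) \<Rightarrow> 'a \<Rightarrow> 'c" where
  "translate h f = (\<lambda>x. f (x + h))"

definition truncate_to :: "'b \<Rightarrow> 'a set \<Rightarrow> ('a \<Rightarrow> ('b, 'q::finite) unordered) \<Rightarrow> 'a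
    \<Rightarrow> ('b, 'q) unordered" where
  "truncate_to y0 K f = (\<lambda>x. if x \<in> K then f x else unordered_const y0)"

end

theory Submission
  imports Defs
begin

text \<open>Total boundedness and completeness of \<open>L\<^sub>p\<close> give the compactness. As the target
  has no linear structure, averaging the maps themselves is not possible; instead one averages over the
  sample points. On a compact set \<open>K\<close>, let \<open>c\<close> be a simple function moving points by less than
  \<open>r\<close>. By Tonelli and translation invariance, the mean over \<open>t\<close> in the ball of radius \<open>r\<close> of
  \<open>\<integral>\<^sub>K dist (f x) (f (c x + t)) powr p\<close> is at most the doubling constant times the
  supremum of \<open>\<integral> dist (f x) (f (x + h)) powr p\<close> over \<open>|h| < 2 r\<close>. So some \<open>t\<close> makes the step
  function \<open>x \<mapsto> f (c x + t)\<close> close to \<open>f\<close> on \<open>K\<close>. Rounding its values to a finite net of the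
  compact target and using \<open>Q[[y0]]\<close> outside \<open>K\<close> leaves finitely many maps.\<close>

section \<open>Separability and measurability\<close>

text \<open>Induction on the spanning set. A new vector \<open>b\<close> outside
  \<open>span B\<close> has positive distance from it, by compactness inside \<open>span B\<close>;
  this bounds the coefficient of \<open>b\<close> in a vector of norm at most \<open>r\<close>, and
  the ball becomes a closed part of the continuous image of a compact product.\<close>

lemma finite_span_compact_cball:
  fixes B :: "'a::real_normed_vector set"
  assumes "finite B"
  shows "compact (span B \<inter> cball 0 r)"
  using assms
proof (induction B arbitrary: r rule: finite_induct)
  case empty
  have "span {} \<inter> cball (0::'a) r = (if 0 \<le> r then {0} else {})" by auto
  then show ?case by simp
next
  case (insert b B)
  show ?case
  proof (cases "b \<in> span B")
    case True
    then show ?thesis using insert.IH by (simp add: span_redundant)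
  next
    case False
    let ?S = "span B \<inter> cball 0 (norm b + 1)"
    have "compact ?S" "0 \<in> ?S" using insert.IH by (auto simp: span_zero)
    then obtain s0 where s0: "s0 \<in> ?S" "\<And>s. s \<in> ?S \<Longrightarrow> norm (b - s0) \<le> norm (b - s)"
      using continuous_attains_inf[of ?S "\<lambda>s. norm (b - s)"]
        continuous_on_norm[OF continuous_on_diff[OF continuous_on_const continuous_on_id]] by blast
    \<comment> \<open>A point of \<open>span B\<close> outside \<open>?S\<close> has norm above
      \<open>norm b + 1\<close>, hence distance above \<open>1\<close> from \<open>b\<close>. So
      \<open>d\<close> bounds from below the distance from \<open>b\<close> to all of
      \<open>span B\<close>, not only to \<open>?S\<close>.\<close>
    define d where "d = min 1 (norm (b - s0))"
    have "d > 0" using s0(1) False by (auto simp: d_def)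
    have d: "d \<le> norm (b - s)" if "s \<in> span B" for s
    proof (cases "s \<in> ?S")
      case True then show ?thesis using s0(2) unfolding d_def by force
    next
      case False
      then have "norm s > norm b + 1" using that by auto
      moreover have "norm s \<le> norm b + norm (b - s)" using norm_triangle_sub[of s b]
        by (simp add: norm_minus_commute)
      ultimately show ?thesis by (simp add: d_def)
    qed
    have c: "\<bar>c\<bar> * d \<le> norm (s + c *\<^sub>R b)" if "s \<in> span B" for s c
    proof (cases "c = 0")
      case False
      have "d \<le> norm (b - (- (1 / c)) *\<^sub>R s)" using that by (intro d span_scale)
      then have "\<bar>c\<bar> * d \<le> norm (c *\<^sub>R (b - (- (1 / c)) *\<^sub>R s))"
        by (simp add: mult_left_mono)
      also have "c *\<^sub>R (b - (- (1 / c)) *\<^sub>R s) = s + c *\<^sub>R b"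
        using False by (simp add: algebra_simps)
      finally show ?thesis .
    qed simp
    \<comment> \<open>\<open>r / d\<close> bounds the coefficient of \<open>b\<close>, and
      \<open>r + r / d * norm b\<close> then bounds the remainder in \<open>span B\<close>.
      \<open>?T\<close> may exceed the ball, whence the intersection with \<open>cball 0 r\<close>
      below.\<close>
    let ?T = "(\<lambda>(c, s). s + c *\<^sub>R b) ` ({- (r / d)..r / d} \<times> (span B \<inter> cball 0 (r + r / d * norm b)))"
    have "compact ?T"
      by (intro compact_continuous_image compact_Times insert.IH)
        (auto simp: case_prod_unfold intro!: continuous_intros)
    moreover have "span (insert b B) \<inter> cball 0 r = ?T \<inter> cball 0 r"
    proof (intro equalityI subsetI IntI)
      fix x assume x: "x \<in> span (insert b B) \<inter> cball 0 r"
      then obtain c where s: "x - c *\<^sub>R b \<in> span B" by (auto simp: span_insert)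
      have "\<bar>c\<bar> * d \<le> r" using c[OF s, of c] x by simp
      then have cr: "\<bar>c\<bar> \<le> r / d" using \<open>d > 0\<close> by (simp add: field_simps)
      have "norm (x - c *\<^sub>R b) \<le> r + r / d * norm b"
        using x norm_triangle_ineq4[of x "c *\<^sub>R b"] mult_right_mono[OF cr, of "norm b"] by auto
      then show "x \<in> ?T" using s cr by (intro image_eqI[of _ _ "(c, x - c *\<^sub>R b)"]) auto
    next
      fix x assume "x \<in> ?T \<inter> cball 0 r"
      then obtain c s where "x = s + c *\<^sub>R b" "s \<in> span B" by auto
      then have "x - c *\<^sub>R b \<in> span B" by simp
      then show "x \<in> span (insert b B)" by (auto simp: span_insert)
    qed auto
    ultimately show ?thesis by (simp add: compact_Int_closed)
  qed
qed

section \<open>Countable dense sets and Borel sets of products\<close>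

text \<open>Collect finite \<open>1 / Suc m\<close>-nets of all the \<open>K n\<close>. This serves
  both the domain, exhausted by closed balls, and the compact target.\<close>

lemma sigma_compact_imp_separable:
  fixes K :: "nat \<Rightarrow> 'a::metric_space set"
  assumes "\<And>n. compact (K n)" and "(\<Union>n. K n) = UNIV"
  shows "\<exists>D :: 'a set. countable D \<and> closure D = UNIV"
proof -
  have "\<exists>k. finite k \<and> K n \<subseteq> (\<Union>x\<in>k. ball x (1 / Suc m))" for n m
  proof -
    have "1 / real (Suc m) > 0" by simp
    then show ?thesis
      using compact_eq_totally_bounded[of "K n"] assms(1)[of n] by meson
  qed
  then obtain k where k: "\<And>n m. finite (k n m)" "\<And>n m. K n \<subseteq> (\<Union>x\<in>k n m. ball x (1 / Suc m))"
    by metis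
  have "x \<in> closure (\<Union>n m. k n m)" for x
  proof (subst closure_approachable, intro allI impI)
    fix e :: real assume "e > 0"
    then obtain m where m: "1 / Suc m < e" using nat_approx_posE by metis
    obtain n where "x \<in> K n" using assms(2) by blast
    then obtain y where "y \<in> k n m" "dist y x < 1 / Suc m" using k(2)[of n m] by auto
    then show "\<exists>y\<in>\<Union>n m. k n m. dist y x < e" using m by (intro bexI[of _ y]) auto
  qed
  moreover have "countable (\<Union>n m. k n m)"
    by (intro countable_UN countableI_type countable_finite k)
  ultimately show ?thesis by blast
qed

text \<open>By density, \<open>W\<close> is the union of the products of balls of radius
  \<open>1 / Suc n\<close> contained in it whose centres lie in \<open>D1\<close> and
  \<open>D2\<close>, and there are only countably many of these.\<close>

lemma open_in_sets_pair_borel: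
  fixes D1 :: "'a::metric_space set" and D2 :: "'b::metric_space set"
    and W :: "('a \<times> 'b) set"
  assumes "countable D1" "closure D1 = UNIV" "countable D2" "closure D2 = UNIV" "open W"
  shows "W \<in> sets (borel \<Otimes>\<^sub>M borel)"
proof -
  let ?R = "\<lambda>(x :: 'a, y :: 'b, n :: nat). ball x (1 / Suc n) \<times> ball y (1 / Suc n)"
  let ?I = "{i \<in> D1 \<times> D2 \<times> UNIV. ?R i \<subseteq> W}"
  have "W = (\<Union>i\<in>?I. ?R i)"
  proof (intro equalityI subsetI)
    fix w assume "w \<in> W"
    obtain x y where w: "w = (x, y)" by (cases w)
    obtain A B where AB: "open A" "open B" "x \<in> A" "y \<in> B" "A \<times> B \<subseteq> W"
      using \<open>open W\<close> \<open>w \<in> W\<close> unfolding w by (rule open_prod_elim) auto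
    obtain a b where ab: "a > 0" "ball x a \<subseteq> A" "b > 0" "ball y b \<subseteq> B"
      using AB by (meson open_contains_ball)
    \<comment> \<open>Half of \<open>min a b\<close>: a point of the ball about \<open>x'\<close> is
      within two such radii of \<open>x\<close>, hence still in \<open>ball x a\<close>; likewise
      for \<open>y\<close>.\<close>
    obtain n where n: "1 / Suc n < min a b / 2" using ab nat_approx_posE[of "min a b / 2"] by auto
    obtain x' where x': "x' \<in> D1" "dist x' x < 1 / Suc n"
      using assms(2) closure_approachable[of x D1] by (metis UNIV_I of_nat_0_less_iff zero_less_Suc zero_less_divide_1_iff)
    obtain y' where y': "y' \<in> D2" "dist y' y < 1 / Suc n"
      using assms(4) closure_approachable[of y D2] by (metis UNIV_I of_nat_0_less_iff zero_less_Suc zero_less_divide_1_iff)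
    have "ball x' (1 / Suc n) \<subseteq> A"
    proof
      fix z assume "z \<in> ball x' (1 / Suc n)"
      then have "dist x z < a" using x' n dist_triangle[of x z x'] by (auto simp: dist_commute)
      then show "z \<in> A" using ab by auto
    qed
    moreover have "ball y' (1 / Suc n) \<subseteq> B"
    proof
      fix z assume "z \<in> ball y' (1 / Suc n)"
      then have "dist y z < b" using y' n dist_triangle[of y z y'] by (auto simp: dist_commute)
      then show "z \<in> B" using ab by auto
    qed
    ultimately have "?R (x', y', n) \<subseteq> W" using AB by auto
    then have "(x', y', n) \<in> ?I" using x' y' by auto
    moreover have "w \<in> ?R (x', y', n)" using x' y' w by auto
    ultimately show "w \<in> (\<Union>i\<in>?I. ?R i)" by blast
  qed auto
  moreover have "(\<Union>i\<in>?I. ?R i) \<in> sets (borel \<Otimes>\<^sub>M borel)"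
  proof (rule sets.countable_UN'')
    show "countable ?I"
      using assms by (intro countable_subset[OF _ countable_SIGMA[of D1 "\<lambda>_. D2 \<times> UNIV"]]) auto
  qed auto
  ultimately show ?thesis by simp
qed

lemma borel_measurable_continuous_Pair_separable:
  fixes D1 :: "'a::metric_space set" and D2 :: "'b::metric_space set"
    and h :: "'a \<times> 'b \<Rightarrow> 'c::topological_space"
  assumes D: "countable D1" "closure D1 = UNIV" "countable D2" "closure D2 = UNIV"
    and h: "continuous_on UNIV h"
    and [measurable]: "f \<in> borel_measurable M" "g \<in> borel_measurable M"
  shows "(\<lambda>x. h (f x, g x)) \<in> borel_measurable M"
proof (rule borel_measurableI)
  fix S :: "'c set" assume "open S"
  then have "open (h -` S)" using h by (simp add: open_vimage)
  then have [measurable]: "h -` S \<in> sets (borel \<Otimes>\<^sub>M borel)"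
    by (rule open_in_sets_pair_borel[OF D])
  have "(\<lambda>x. h (f x, g x)) -` S \<inter> space M = (\<lambda>x. (f x, g x)) -` (h -` S) \<inter> space M" by auto
  also have "\<dots> \<in> sets M" by measurable
  finally show "(\<lambda>x. h (f x, g x)) -` S \<inter> space M \<in> sets M" .
qed

section \<open>Compactness in semimetric spaces\<close>

text \<open>Distinct points may be at distance \<open>0\<close>, so the metric criterion (complete
  and totally bounded) does not apply to \<open>L\<close> itself. It transfers because a set open in
  \<open>T\<close> contains, with a point, every point of \<open>L\<close> at distance
  \<open>0\<close> from it.\<close>

lemma compactin_closure_of_semimetric:
  fixes d :: "'a \<Rightarrow> 'a \<Rightarrow> real"
  assumes nonneg: "\<And>x y. 0 \<le> d x y"
    and commute: "\<And>x y. d x y = d y x"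
    and refl: "\<And>x. x \<in> L \<Longrightarrow> d x x = 0"
    and tri: "\<And>x y z. x \<in> L \<Longrightarrow> y \<in> L \<Longrightarrow> z \<in> L \<Longrightarrow> d x z \<le> d x y + d y z"
    and openin: "\<And>U. openin T U \<longleftrightarrow> U \<subseteq> L \<and> (\<forall>x\<in>U. \<exists>r>0. \<forall>y\<in>L. d x y < r \<longrightarrow> y \<in> U)"
    and complete: "\<And>s. range s \<subseteq> L \<Longrightarrow>
      (\<And>e. e > 0 \<Longrightarrow> \<exists>N. \<forall>m\<ge>N. \<forall>n\<ge>N. d (s m) (s n) < e) \<Longrightarrow> \<exists>x\<in>L. (\<lambda>n. d (s n) x) \<longlonglongrightarrow> 0"
    and S: "S \<subseteq> L"
    and bounded: "\<And>e. e > 0 \<Longrightarrow> \<exists>K. finite K \<and> K \<subseteq> L \<and> (\<forall>x\<in>S. \<exists>y\<in>K. d y x < e)"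
  shows "compactin T (T closure_of S)"
proof -
  \<comment> \<open>Choosing one point in each class of points at distance \<open>0\<close> yields a genuine metric space.\<close>
  define rep where "rep x = (SOME y. y \<in> L \<and> d x y = 0)" for x
  have "rep x \<in> L \<and> d x (rep x) = 0" if "x \<in> L" for x
    unfolding rep_def by (rule someI_ex) (use refl that in blast)
  then have rep: "rep x \<in> L" "d x (rep x) = 0" "d (rep x) x = 0" if "x \<in> L" for x
    using that commute[of "rep x" x] by simp_all
  have d_cong: "d x y = d x' y'" if "d x x' = 0" "d y y' = 0" "x \<in> L" "x' \<in> L" "y \<in> L" "y' \<in> L" for x x' y y'
    using tri[of x x' y] tri[of x' y' y] tri[of x' x y'] tri[of x y y'] that
      commute[of x x'] commute[of y y'] by linarith
  have rep_eq: "rep x = rep y" if "d x y = 0" "x \<in> L" "y \<in> L" for x y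
  proof -
    have "d x z = d y z" if "z \<in> L" for z
      by (rule d_cong) (use that \<open>d x y = 0\<close> \<open>x \<in> L\<close> \<open>y \<in> L\<close> refl in auto)
    then have "(\<lambda>z. z \<in> L \<and> d x z = 0) = (\<lambda>z. z \<in> L \<and> d y z = 0)" by auto
    then show ?thesis unfolding rep_def by simp
  qed
  let ?M = "rep ` L"
  have M_L: "?M \<subseteq> L" using rep by blast
  interpret Metric_space ?M d
  proof
    fix x y assume xy: "x \<in> ?M" "y \<in> ?M"
    then have "rep x = x" "rep y = y" using rep rep_eq M_L by (metis imageE)+
    then show "d x y = 0 \<longleftrightarrow> x = y" using rep_eq xy M_L refl by (metis subsetD)
  next
    fix x y z assume "x \<in> ?M" "y \<in> ?M" "z \<in> ?M"
    then show "d x z \<le> d x y + d y z" using M_L by (intro tri) auto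
  qed (rule nonneg, rule commute)
  have "\<forall>x\<in>L. \<exists>r>0::real. \<forall>y\<in>L. d x y < r \<longrightarrow> y \<in> L" using zero_less_one by blast
  then have topT: "topspace T = L"
    using openin[THEN iffD1, OF openin_topspace] openin_subset[OF openin[THEN iffD2], of L] by blast
  have mem: "rep x \<in> U \<longleftrightarrow> x \<in> U" if "openin T U" "x \<in> L" for x U
  proof -
    have "y \<in> U" if "x \<in> U" "y \<in> L" "d x y = 0" for x y
      using openin[THEN iffD1, OF \<open>openin T U\<close>] that by (metis zero_less_one)
    then show ?thesis using rep that by metis
  qed
  have open_M: "openin mtopology (U \<inter> ?M)" if U: "openin T U" for U
    unfolding openin_mtopology
  proof (intro conjI allI impI)
    fix x assume "x \<in> U \<inter> ?M"
    then obtain r where "r > 0" "\<forall>y\<in>L. d x y < r \<longrightarrow> y \<in> U" using openin[THEN iffD1, OF U] by blast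
    then show "\<exists>r>0. mball x r \<subseteq> U \<inter> ?M" using M_L by (intro exI[of _ r]) (auto simp: subset_iff)
  qed auto
  \<comment> \<open>The triangle inequality makes the \<open>d\<close>-ball \<open>?U\<close> open
    in \<open>T\<close>, so it meets \<open>S\<close>; passing to representatives does not change
    distances.\<close>
  have clo: "rep x \<in> mtopology closure_of (rep ` S)" if x: "x \<in> T closure_of S" for x
  proof -
    have xL: "x \<in> L" using x topT in_closure_of by metis
    have "\<exists>y\<in>rep ` S. y \<in> mball (rep x) r" if r: "r > 0" for r
    proof -
      let ?U = "{y \<in> L. d x y < r}"
      have "openin T ?U" unfolding openin
      proof (intro conjI ballI)
        fix y assume y: "y \<in> ?U"
        have "d x z < r" if "z \<in> L" "d y z < r - d x y" for z
          using tri[of x y z] xL y that by auto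
        then show "\<exists>s>0. \<forall>z\<in>L. d y z < s \<longrightarrow> z \<in> ?U" using y by (intro exI[of _ "r - d x y"]) auto
      qed auto
      then obtain y where "y \<in> S" "y \<in> ?U"
        using x xL refl r unfolding in_closure_of by (metis (no_types, lifting) mem_Collect_eq)
      then have "d (rep x) (rep y) < r" using d_cong[of x "rep x" y "rep y"] rep xL by auto
      then show ?thesis using \<open>y \<in> S\<close> xL S by auto
    qed
    then show ?thesis using xL by (auto simp: metric_closure_of)
  qed
  have "mcomplete" unfolding mcomplete_def
  proof (intro allI impI)
    fix s assume s: "MCauchy s"
    then have M: "range s \<subseteq> ?M"
      and "\<forall>e>0. \<exists>N. \<forall>m n. N \<le> m \<longrightarrow> N \<le> n \<longrightarrow> d (s m) (s n) < e"
      unfolding MCauchy_def by (rule conjunct1, rule conjunct2)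
    then have "\<exists>N. \<forall>m\<ge>N. \<forall>n\<ge>N. d (s m) (s n) < e" if "e > 0" for e using that by meson
    moreover have "range s \<subseteq> L" using M M_L by (rule subset_trans)
    ultimately obtain x where x: "x \<in> L" "(\<lambda>n. d (s n) x) \<longlonglongrightarrow> 0" using complete by blast
    have "d (s n) (rep x) = d (s n) x" for n
      using \<open>range s \<subseteq> L\<close> x rep by (intro d_cong refl) auto
    then have "(\<lambda>n. d (s n) (rep x)) \<longlonglongrightarrow> 0" using x(2) by simp
    then have "limitin mtopology s (rep x) sequentially"
      using M x(1) by (auto simp: limitin_metric_dist_null intro!: always_eventually)
    then show "\<exists>x. limitin mtopology s x sequentially" ..
  qed
  moreover have "mtotally_bounded (rep ` S)" unfolding mtotally_bounded_def
  proof (intro allI impI)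
    fix e :: real assume "e > 0"
    then obtain K where K: "finite K" "K \<subseteq> L" "\<And>x. x \<in> S \<Longrightarrow> \<exists>y\<in>K. d y x < e / 2"
      using bounded[of "e / 2"] by auto
    define K' where "K' = {y \<in> K. \<exists>x\<in>S. d y x < e / 2}"
    have "\<forall>y\<in>K'. \<exists>x. x \<in> S \<and> d y x < e / 2" unfolding K'_def by blast
    then obtain q where q: "\<And>y. y \<in> K' \<Longrightarrow> q y \<in> S \<and> d y (q y) < e / 2" by metis
    show "\<exists>J. finite J \<and> J \<subseteq> rep ` S \<and> rep ` S \<subseteq> (\<Union>x\<in>J. mball x e)"
    proof (intro exI[of _ "rep ` q ` K'"] conjI subsetI)
      show "finite (rep ` q ` K')" using K by (auto simp: K'_def)
      show "x \<in> rep ` S" if "x \<in> rep ` q ` K'" for x using q that by auto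
      fix x assume "x \<in> rep ` S"
      then obtain z where z: "z \<in> S" "x = rep z" by blast
      then obtain y where y: "y \<in> K" "d y z < e / 2" using K by blast
      then have "y \<in> K'" using z by (auto simp: K'_def)
      have L: "q y \<in> L" "y \<in> L" "z \<in> L" using q[OF \<open>y \<in> K'\<close>] S y z K by auto
      have "d (q y) z < e"
        using tri[OF L] q[OF \<open>y \<in> K'\<close>] y commute[of "q y" y] by linarith
      then have "d (rep (q y)) (rep z) < e"
        using d_cong[of "q y" "rep (q y)" z "rep z"] rep L by simp
      then show "x \<in> (\<Union>x\<in>rep ` q ` K'. mball x e)"
        using L z \<open>y \<in> K'\<close> by auto
    qed
  qed
  ultimately have comp: "compactin mtopology (mtopology closure_of (rep ` S))"
    by (simp add: mtotally_bounded_eq_compact_closure_of)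
  show ?thesis unfolding compactin_def
  proof (intro conjI allI impI)
    show "T closure_of S \<subseteq> topspace T" by (rule closure_of_subset_topspace)
    fix \<U> assume U: "Ball \<U> (openin T) \<and> T closure_of S \<subseteq> \<Union> \<U>"
    let ?V = "(\<lambda>U. U \<inter> ?M) ` insert (topspace T - T closure_of S) \<U>"
    have op: "openin T (topspace T - T closure_of S)" by (simp add: openin_diff)
    have "mtopology closure_of (rep ` S) \<subseteq> ?M" using closure_of_subset_topspace[of mtopology] by simp
    moreover have "?M \<subseteq> \<Union> (insert (topspace T - T closure_of S) \<U>)"
      using U topT M_L by auto
    ultimately have "mtopology closure_of (rep ` S) \<subseteq> \<Union> ?V" by auto
    moreover have "Ball ?V (openin mtopology)" using U op open_M by auto
    ultimately obtain \<V> where V: "finite \<V>" "\<V> \<subseteq> ?V" "mtopology closure_of (rep ` S) \<subseteq> \<Union> \<V>"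
      using comp unfolding compactin_def by meson
    then obtain \<W> where W: "finite \<W>" "\<W> \<subseteq> insert (topspace T - T closure_of S) \<U>"
      "\<V> = (\<lambda>U. U \<inter> ?M) ` \<W>" using finite_subset_image by metis
    show "\<exists>\<F>. finite \<F> \<and> \<F> \<subseteq> \<U> \<and> T closure_of S \<subseteq> \<Union> \<F>"
    proof (intro exI[of _ "\<W> \<inter> \<U>"] conjI subsetI)
      fix x assume x: "x \<in> T closure_of S"
      then have xL: "x \<in> L" using topT in_closure_of by metis
      obtain U where "U \<in> \<W>" "rep x \<in> U" using clo[OF x] V(3) W(3) by blast
      moreover have "openin T U" using W(2) U op \<open>U \<in> \<W>\<close> by blast
      ultimately have "x \<in> U" using mem xL by blast
      then show "x \<in> \<Union> (\<W> \<inter> \<U>)" using x W(2) \<open>U \<in> \<W>\<close> by blast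
    qed (use W in auto)
  qed
qed

section \<open>The compact space of unordered tuples\<close>

text \<open>The product is compact by Tychonoff, and the quotient map is 1-Lipschitz: the identity
  permutation is one of the competitors in the minimum defining the distance.\<close>

lemma compact_UNIV_unordered:
  assumes "compact (UNIV :: 'b::metric_space set)"
  shows "compact (UNIV :: ('b, 'q::finite) unordered set)"
proof -
  have "compact_space (product_topology (\<lambda>_ :: 'q. euclidean :: 'b topology) UNIV)"
    using assms unfolding compact_space_product_topology by (simp add: compact_space_def)
  then have "compact (UNIV :: ('q \<Rightarrow> 'b) set)"
    by (simp add: euclidean_product_topology compact_space_def)
  then have "compact ((\<lambda>y :: 'q \<Rightarrow> 'b. \<chi> i. y i) ` UNIV)"
    by (intro compact_continuous_image continuous_on_vec_lambda continuous_on_product_coordinates)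
  moreover have "range (\<lambda>y :: 'q \<Rightarrow> 'b. \<chi> i. y i) = UNIV"
    by (metis surjI vec_nth_inverse)
  ultimately have "compact (UNIV :: ('b ^ 'q) set)" by simp
  moreover have "continuous_on UNIV (unordered_class :: 'b ^ 'q \<Rightarrow> _)"
  proof (rule continuous_on_iff[THEN iffD2], intro ballI allI impI)
    fix y :: "'b ^ 'q" and e :: real assume "e > 0"
    have "dist (unordered_class z) (unordered_class y) \<le> dist z y" for z :: "'b ^ 'q"
      using G2_rep_le[OF permutes_id, of z y] by (simp add: dist_unordered.abs_eq)
    then show "\<exists>d>0. \<forall>z\<in>UNIV. dist z y < d \<longrightarrow> dist (unordered_class z) (unordered_class y) < e"
      using \<open>e > 0\<close> by (meson le_less_trans)
  qed
  ultimately have "compact (range (unordered_class :: 'b ^ 'q \<Rightarrow> _))"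
    by (intro compact_continuous_image)
  moreover have "range (unordered_class :: 'b ^ 'q \<Rightarrow> _) = UNIV"
    by (metis Quotient3_def Quotient3_unordered surjI)
  ultimately show ?thesis by simp
qed

text \<open>Compactness enters through separability, which makes the continuous function
  \<open>dist\<close> measurable for the product of the two Borel sigma-algebras.\<close>

lemma borel_measurable_dist_compact:
  fixes f g :: "'a \<Rightarrow> 'c::metric_space"
  assumes "compact (UNIV :: 'c set)" and fg: "f \<in> borel_measurable M" "g \<in> borel_measurable M"
  shows "(\<lambda>x. dist (f x) (g x)) \<in> borel_measurable M"
proof -
  obtain D :: "'c set" where D: "countable D" "closure D = UNIV"
    using sigma_compact_imp_separable[of "\<lambda>_. UNIV :: 'c set"] assms by auto
  have "continuous_on UNIV (\<lambda>z :: 'c \<times> 'c. dist (fst z) (snd z))"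
    by (intro continuous_intros)
  from borel_measurable_continuous_Pair_separable[OF D D this fg] show ?thesis by simp
qed

section \<open>The semimetric and its completeness\<close>

text \<open>For positive \<open>u\<close> and \<open>v\<close> this is convexity of the power; if
  one of them is \<open>0\<close> it reduces to \<open>s powr p \<le> s\<close> for
  \<open>0 < s < 1\<close>.\<close>

lemma powr_convex_combination:
  fixes u v t p :: real
  assumes "1 \<le> p" "0 \<le> u" "0 \<le> v" "0 < t" "t < 1"
  shows "((1 - t) * u + t * v) powr p \<le> (1 - t) * u powr p + t * v powr p"
proof -
  have le: "(s * w) powr p \<le> s * w powr p" if "0 < s" "s < 1" "0 \<le> w" for s w :: real
  proof -
    have "s powr p \<le> s powr 1" using that assms by (intro powr_mono') auto
    then show ?thesis using that by (simp add: powr_mult mult_right_mono)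
  qed
  consider "u = 0" | "v = 0" | "u > 0" "v > 0" using assms by linarith
  then show ?thesis
  proof cases
    case 3
    then show ?thesis
      using convex_onD[OF powr_convex[OF assms(1)], of t u v] assms by simp
  qed (use assms le[of t v] le[of "1 - t" u] in auto)
qed

lemma powr_add_le:
  fixes u v p :: real
  assumes "1 \<le> p" "0 \<le> u" "0 \<le> v"
  shows "(u + v) powr p \<le> 2 powr p * (u powr p + v powr p)"
proof -
  have "(u + v) powr p \<le> (2 * max u v) powr p" using assms by (intro powr_mono2) auto
  also have "\<dots> = 2 powr p * max u v powr p" using assms by (simp add: powr_mult)
  also have "\<dots> \<le> 2 powr p * (u powr p + v powr p)"
    by (intro mult_left_mono) (auto simp: max_def)
  finally show ?thesis .
qed

text \<open>With \<open>a\<close> and \<open>b\<close> close to the two norms,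
  \<open>(u + v) / (a + b)\<close> is a convex combination of \<open>u / a\<close> and
  \<open>v / b\<close>, so convexity of the power can be integrated. Having \<open>w\<close> below
  \<open>u + v\<close> lets the triangle inequality of \<open>dist\<close> be inserted
  directly.\<close>

lemma Minkowski_integral:
  fixes u v w :: "'a \<Rightarrow> real"
  assumes p: "1 \<le> p"
    and u: "integrable M (\<lambda>x. u x powr p)" "\<And>x. 0 \<le> u x"
    and v: "integrable M (\<lambda>x. v x powr p)" "\<And>x. 0 \<le> v x"
    and w: "\<And>x. 0 \<le> w x" "\<And>x. w x \<le> u x + v x"
  shows "(\<integral>x. w x powr p \<partial>M) powr (1 / p)
    \<le> (\<integral>x. u x powr p \<partial>M) powr (1 / p) + (\<integral>x. v x powr p \<partial>M) powr (1 / p)"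
    (is "?W \<le> ?U + ?V")
proof (rule field_le_epsilon)
  fix e :: real assume e: "e > 0"
  \<comment> \<open>The margin \<open>e / 2\<close> keeps the divisors positive when one of the two norms vanishes.\<close>
  define a b where "a = ?U + e / 2" and "b = ?V + e / 2"
  have ab: "a > 0" "b > 0" using e by (auto simp: a_def b_def add_nonneg_pos)
  define t where "t = b / (a + b)"
  have t: "0 < t" "t < 1" "1 - t = a / (a + b)" using ab by (auto simp: t_def field_simps)
  have U: "(\<integral>x. u x powr p \<partial>M) \<le> a powr p" and V: "(\<integral>x. v x powr p \<partial>M) \<le> b powr p"
  proof -
    have "?U powr p \<le> a powr p" "?V powr p \<le> b powr p"
      using e p by (auto intro!: powr_mono2 simp: a_def b_def)
    then show "(\<integral>x. u x powr p \<partial>M) \<le> a powr p" "(\<integral>x. v x powr p \<partial>M) \<le> b powr p"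
      using p by (simp_all add: powr_powr)
  qed
  let ?h = "\<lambda>x. (a + b) powr p * ((1 - t) * (u x powr p / a powr p) + t * (v x powr p / b powr p))"
  have "w x powr p \<le> ?h x" for x
  proof -
    have "(1 - t) * (u x / a) + t * (v x / b) = (u x + v x) / (a + b)"
      using ab by (simp add: t(3)) (simp add: t_def add_divide_distrib)
    then have "u x + v x = (a + b) * ((1 - t) * (u x / a) + t * (v x / b))"
      using ab by simp
    then have "w x powr p \<le> ((a + b) * ((1 - t) * (u x / a) + t * (v x / b))) powr p"
      using w[of x] p by (intro powr_mono2) auto
    also have "\<dots> = (a + b) powr p * ((1 - t) * (u x / a) + t * (v x / b)) powr p"
      by (rule powr_mult)
    also have "\<dots> \<le> (a + b) powr p * ((1 - t) * (u x / a) powr p + t * (v x / b) powr p)"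
      using ab t u v p by (intro mult_left_mono powr_convex_combination) auto
    also have "\<dots> = ?h x" using ab u v by (simp add: powr_divide)
    finally show ?thesis .
  qed
  \<comment> \<open>A nonnegative bound keeps the comparison valid under the convention that a
    divergent Bochner integral is \<open>0\<close>.\<close>
  moreover have "0 \<le> ?h x" for x using ab t by (intro mult_nonneg_nonneg add_nonneg_nonneg) auto
  ultimately have "(\<integral>x. w x powr p \<partial>M) \<le> (\<integral>x. ?h x \<partial>M)"
    using u v by (intro integral_mono') auto
  also have "\<dots> = (a + b) powr p * ((1 - t) * ((\<integral>x. u x powr p \<partial>M) / a powr p)
      + t * ((\<integral>x. v x powr p \<partial>M) / b powr p))"
    using u v by simp
  also have "\<dots> \<le> (a + b) powr p * ((1 - t) * 1 + t * 1)"
    using U V ab t by (intro mult_left_mono add_mono) auto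
  finally have "(\<integral>x. w x powr p \<partial>M) \<le> (a + b) powr p" by simp
  then have "?W \<le> ((a + b) powr p) powr (1 / p)"
    using p by (intro powr_mono2) auto
  also have "\<dots> = a + b" using ab p by (simp add: powr_powr)
  finally show "?W \<le> ?U + ?V + e" by (simp add: a_def b_def)
qed

section \<open>The semimetric and membership in L_p\<close>

lemma Lp_dist_nonneg: "0 \<le> Lp_dist p M f g"
  by (simp add: Lp_dist_def)

lemma Lp_dist_commute: "Lp_dist p M f g = Lp_dist p M g f"
  by (simp add: Lp_dist_def dist_commute)

lemma Lp_dist_powr:
  assumes "1 \<le> p"
  shows "Lp_dist p M f g powr p = (\<integral>x. dist (f x) (g x) powr p \<partial>M)"
  using assms by (simp add: Lp_dist_def powr_powr)

context
  fixes p :: real and M :: "'a::topological_space measure" and y0 :: "'b::metric_space"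
  assumes p: "1 \<le> p" and compact_Y: "compact (UNIV :: 'b set)"
begin

lemma Lp_maps_integrable_dist:
  fixes f g :: "'a \<Rightarrow> ('b, 'q::finite) unordered"
  assumes f: "f \<in> Lp_maps p M y0" and g: "g \<in> Lp_maps p M y0"
  shows "integrable M (\<lambda>x. dist (f x) (g x) powr p)"
proof (rule Bochner_Integration.integrable_bound)
  let ?c = "unordered_const y0 :: ('b, 'q) unordered"
  show "integrable M (\<lambda>x. 2 powr p * (dist (f x) ?c powr p + dist (g x) ?c powr p))"
    using f g by (auto simp: Lp_maps_def)
  have "(\<lambda>x. dist (f x) (g x)) \<in> borel_measurable M"
    using f g by (intro borel_measurable_dist_compact compact_UNIV_unordered compact_Y)
      (auto simp: Lp_maps_def)
  then show "(\<lambda>x. dist (f x) (g x) powr p) \<in> borel_measurable M" by measurable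
  have "dist (f x) (g x) powr p \<le> (dist (f x) ?c + dist (g x) ?c) powr p" for x
    using p by (intro powr_mono2 dist_triangle2) auto
  also have "\<dots> x \<le> 2 powr p * (dist (f x) ?c powr p + dist (g x) ?c powr p)" for x
    using p by (intro powr_add_le) auto
  finally show "AE x in M. norm (dist (f x) (g x) powr p)
      \<le> norm (2 powr p * (dist (f x) ?c powr p + dist (g x) ?c powr p))"
    by (intro AE_I2) (simp add: abs_mult)
qed

lemma Lp_dist_triangle:
  fixes f g h :: "'a \<Rightarrow> ('b, 'q::finite) unordered"
  assumes "f \<in> Lp_maps p M y0" "g \<in> Lp_maps p M y0" "h \<in> Lp_maps p M y0"
  shows "Lp_dist p M f h \<le> Lp_dist p M f g + Lp_dist p M g h"
  unfolding Lp_dist_def using assms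
  by (intro Minkowski_integral p Lp_maps_integrable_dist dist_triangle) auto

text \<open>The bridge to nonnegative integrals, in which Fatou and Tonelli are applied.\<close>

lemma nn_integral_Lp_dist:
  fixes f g :: "'a \<Rightarrow> ('b, 'q::finite) unordered"
  assumes "f \<in> Lp_maps p M y0" "g \<in> Lp_maps p M y0"
  shows "(\<integral>\<^sup>+x. ennreal (dist (f x) (g x) powr p) \<partial>M) = ennreal (Lp_dist p M f g powr p)"
  using Lp_maps_integrable_dist[OF assms] p by (simp add: Lp_dist_powr nn_integral_eq_integral)

text \<open>Finite distance from one member suffices, by the triangle inequality through
  \<open>f\<close>. The measure may be infinite, so boundedness of the target alone would not give
  membership.\<close>

lemma Lp_mapsI:
  fixes f g :: "'a \<Rightarrow> ('b, 'q::finite) unordered"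
  assumes f: "f \<in> Lp_maps p M y0" and g: "g \<in> borel_measurable M"
    and fin: "(\<integral>\<^sup>+x. ennreal (dist (f x) (g x) powr p) \<partial>M) < \<infinity>"
  shows "g \<in> Lp_maps p M y0"
proof -
  let ?c = "unordered_const y0 :: ('b, 'q) unordered"
  have meas: "(\<lambda>x. dist (h x) (k x) powr p) \<in> borel_measurable M"
    if "h \<in> borel_measurable M" "k \<in> borel_measurable M" for h k :: "'a \<Rightarrow> ('b, 'q) unordered"
    using borel_measurable_dist_compact[OF compact_UNIV_unordered[OF compact_Y] that] by measurable
  have fM: "f \<in> borel_measurable M" "integrable M (\<lambda>x. dist (f x) ?c powr p)"
    using f by (auto simp: Lp_maps_def)
  have fg: "integrable M (\<lambda>x. dist (f x) (g x) powr p)"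
    using fin meas[OF fM(1) g] by (intro integrableI_bounded) auto
  have "integrable M (\<lambda>x. dist (g x) ?c powr p)"
  proof (rule Bochner_Integration.integrable_bound)
    show "integrable M (\<lambda>x. 2 powr p * (dist (f x) (g x) powr p + dist (f x) ?c powr p))"
      using fM fg by auto
    show "(\<lambda>x. dist (g x) ?c powr p) \<in> borel_measurable M" by (intro meas g) simp
    have "dist (g x) ?c powr p \<le> (dist (f x) (g x) + dist (f x) ?c) powr p" for x
      using p dist_triangle3[of "g x" ?c "f x"] by (intro powr_mono2) auto
    also have "\<dots> x \<le> 2 powr p * (dist (f x) (g x) powr p + dist (f x) ?c powr p)" for x
      using p by (intro powr_add_le) auto
    finally show "AE x in M. norm (dist (g x) ?c powr p)
        \<le> norm (2 powr p * (dist (f x) (g x) powr p + dist (f x) ?c powr p))"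
      by (intro AE_I2) (simp add: abs_mult)
  qed
  then show ?thesis using g by (simp add: Lp_maps_def)
qed

end

section \<open>Completeness\<close>

lemma Cauchy_if_dist_Suc_less_half_power:
  fixes u :: "nat \<Rightarrow> 'c::metric_space"
  assumes "eventually (\<lambda>k. dist (u k) (u (Suc k)) < (1 / 2) ^ k) sequentially"
  shows "Cauchy u"
proof -
  obtain K where K: "\<And>k. k \<ge> K \<Longrightarrow> dist (u k) (u (Suc k)) < (1 / 2) ^ k"
    using assms by (auto simp: eventually_sequentially)
  \<comment> \<open>The right-hand side is the geometric sum of \<open>(1 / 2) ^ i\<close> over
    \<open>k \<le> i < k + j\<close>, in a form that telescopes.\<close>
  have *: "dist (u k) (u (k + j)) \<le> 2 * (1 / 2) ^ k - 2 * (1 / 2) ^ (k + j)" if "k \<ge> K" for k j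
  proof (induction j)
    case (Suc j)
    then show ?case
      using K[of "k + j"] that dist_triangle[of "u k" "u (k + Suc j)" "u (k + j)"] by simp
  qed simp
  show ?thesis
  proof (rule metric_CauchyI)
    fix e :: real assume "e > 0"
    then obtain N where N: "(1 / 2) ^ N < e / 4" using real_arch_pow_inv[of "e / 4" "1 / 2"] by auto
    define L where "L = max K N"
    have L: "dist (u L) (u m) < e / 2" if "m \<ge> L" for m
    proof -
      have "dist (u L) (u m) \<le> 2 * (1 / 2) ^ L - 2 * (1 / 2) ^ m"
        using *[of L "m - L"] that by (simp add: L_def)
      also have "\<dots> < 2 * (1 / 2) ^ L" by simp
      also have "\<dots> \<le> 2 * (1 / 2) ^ N"
        by (intro mult_left_mono power_decreasing) (auto simp: L_def)
      finally show ?thesis using N by simp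
    qed
    have "dist (u m) (u n) < e" if "m \<ge> L" "n \<ge> L" for m n
      using L[OF that(1)] L[OF that(2)] dist_triangle3[of "u m" "u n" "u L"] by linarith
    then show "\<exists>L. \<forall>m\<ge>L. \<forall>n\<ge>L. dist (u m) (u n) < e" by blast
  qed
qed

text \<open>The Riesz-Fischer argument: Markov and Borel-Cantelli make a fast subsequence Cauchy
  almost everywhere, the compact target supplies pointwise limits, and Fatou turns these into
  convergence of the whole sequence.\<close>

lemma Lp_complete:
  fixes s :: "nat \<Rightarrow> 'a::topological_space \<Rightarrow> ('b::metric_space, 'q::finite) unordered"
  assumes p: "1 \<le> p" and Y: "compact (UNIV :: 'b set)"
    and s: "range s \<subseteq> Lp_maps p M y0"
    and Cauchy: "\<And>e. e > 0 \<Longrightarrow> \<exists>N. \<forall>m\<ge>N. \<forall>n\<ge>N. Lp_dist p M (s m) (s n) < e"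
  shows "\<exists>g\<in>Lp_maps p M y0. (\<lambda>n. Lp_dist p M (s n) g) \<longlonglongrightarrow> 0"
proof -
  have Z: "compact (UNIV :: ('b, 'q) unordered set)" by (rule compact_UNIV_unordered[OF Y])
  have sL: "s n \<in> Lp_maps p M y0" for n using s by auto
  then have [measurable]: "s n \<in> borel_measurable M" for n by (auto simp: Lp_maps_def)
  \<comment> \<open>Distances below \<open>(1 / 4) ^ k\<close>, tested by Markov at the threshold
    \<open>(1 / 2) ^ k\<close>, leave an exceptional set of measure at most
    \<open>((1 / 2) ^ k) powr p \<le> (1 / 2) ^ k\<close>, which is summable.\<close>
  have "\<exists>N. \<forall>m\<ge>N. \<forall>n\<ge>N. Lp_dist p M (s m) (s n) < (1 / 4) ^ k" for k by (intro Cauchy) simp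
  then obtain N where N: "\<And>k m n. m \<ge> N k \<Longrightarrow> n \<ge> N k \<Longrightarrow> Lp_dist p M (s m) (s n) < (1 / 4) ^ k"
    by metis
  \<comment> \<open>The sum makes \<open>r\<close> monotone and at least \<open>N\<close>; the
    summand \<open>k\<close> drives it to infinity.\<close>
  define r where "r k = (\<Sum>j\<le>k. N j) + k" for k
  have rN: "N k \<le> r k" for k
    using member_le_sum[of k "{..k}" N] by (auto simp: r_def)
  have rSuc: "r k \<le> r (Suc k)" for k by (simp add: r_def)
  have rk: "k \<le> r k" for k by (simp add: r_def)
  define u where "u k = s (r k)" for k
  have uL: "u k \<in> Lp_maps p M y0" for k by (simp add: u_def sL)
  have uM[measurable]: "u k \<in> borel_measurable M" for k by (simp add: u_def)
  have int_u: "integrable M (\<lambda>x. dist (u k x) (u (Suc k) x) powr p)" for k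
    by (rule Lp_maps_integrable_dist[OF p Y uL uL])
  define A where "A k = {x \<in> space M. ((1 / 2) ^ k) powr p \<le> dist (u k x) (u (Suc k) x) powr p}" for k
  have A_sets[measurable]: "A k \<in> sets M" for k
    unfolding A_def using borel_measurable_integrable[OF int_u[of k]] by measurable
  have A_le: "emeasure M (A k) \<le> ennreal ((1 / 2) ^ k)" for k
  proof -
    have "emeasure M (A k)
        \<le> (1 / ((1 / 2) ^ k) powr p) * (\<integral>x. dist (u k x) (u (Suc k) x) powr p \<partial>M)"
      unfolding A_def by (intro integral_Markov_inequality int_u) auto
    also have "\<dots> \<le> ennreal ((1 / 2) ^ k)"
    proof (rule ennreal_leI)
      have "Lp_dist p M (u k) (u (Suc k)) < (1 / 4) ^ k"
        unfolding u_def using rN[of k] rSuc[of k] by (intro N) auto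
      then have "(\<integral>x. dist (u k x) (u (Suc k) x) powr p \<partial>M) \<le> ((1 / 4) ^ k) powr p"
        unfolding Lp_dist_powr[OF p, symmetric] using p Lp_dist_nonneg by (intro powr_mono2) auto
      also have "((1 / 4 :: real) ^ k) powr p = ((1 / 2) ^ k) powr p * ((1 / 2) ^ k) powr p"
        by (simp add: powr_mult[symmetric] power_mult_distrib[symmetric])
      finally have "(1 / ((1 / 2) ^ k) powr p) * (\<integral>x. dist (u k x) (u (Suc k) x) powr p \<partial>M)
          \<le> ((1 / 2) ^ k) powr p"
        by (simp add: field_simps)
      also have "\<dots> \<le> ((1 / 2) ^ k) powr 1"
        using p by (intro powr_mono') (auto simp: power_le_one)
      finally show "(1 / ((1 / 2) ^ k) powr p) * (\<integral>x. dist (u k x) (u (Suc k) x) powr p \<partial>M)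
          \<le> (1 / 2) ^ k" by simp
    qed
    finally show ?thesis .
  qed
  have "AE x in M. eventually (\<lambda>k. x \<in> space M - A k) sequentially"
  proof (rule borel_cantelli_AE1)
    show "emeasure M (A k) < \<infinity>" for k using A_le[of k] by (simp add: le_less_trans)
    show "summable (\<lambda>k. measure M (A k))"
    proof (rule summable_comparison_test')
      show "summable (\<lambda>k. (1 / 2 :: real) ^ k)" by (intro summable_geometric) simp
      show "norm (measure M (A k)) \<le> (1 / 2) ^ k" for k
        using A_le[of k] by (simp add: measure_def enn2real_leI)
    qed
  qed simp
  then have "AE x in M. Cauchy (\<lambda>k. u k x)"
  proof (rule AE_mp, intro AE_I2 impI)
    fix x assume "x \<in> space M" and ev: "eventually (\<lambda>k. x \<in> space M - A k) sequentially"
    have less: "dist (u k x) (u (Suc k) x) < (1 / 2) ^ k" if "x \<in> space M - A k" for k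
    proof (rule ccontr)
      assume "\<not> ?thesis"
      then have "((1 / 2) ^ k) powr p \<le> dist (u k x) (u (Suc k) x) powr p"
        using p by (intro powr_mono2) auto
      then show False using that by (auto simp: A_def)
    qed
    show "Cauchy (\<lambda>k. u k x)"
      by (rule Cauchy_if_dist_Suc_less_half_power, rule eventually_mono[OF ev less])
  qed
  then obtain E where E: "{x \<in> space M. \<not> Cauchy (\<lambda>k. u k x)} \<subseteq> E" "emeasure M E = 0" "E \<in> sets M"
    by (rule AE_E)
  note E(3)[measurable]
  have AE_E: "AE x in M. x \<notin> E" using E by (intro AE_not_in) (auto simp: null_sets_def)
  let ?c = "unordered_const y0 :: ('b, 'q) unordered"
  \<comment> \<open>Resetting the maps on the measurable null set \<open>E\<close> yields
    convergence at every point, so that the limit is Borel measurable and not merely defined almost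
    everywhere.\<close>
  define v where "v k x = (if x \<in> E then ?c else u k x)" for k x
  have v[measurable]: "v k \<in> borel_measurable M" for k unfolding v_def by measurable
  have "\<exists>z. (\<lambda>k. v k x) \<longlonglongrightarrow> z" if "x \<in> space M" for x
  proof (cases "x \<in> E")
    case False
    then have "Cauchy (\<lambda>k. v k x)" using E that by (auto simp: v_def)
    then show ?thesis using compact_imp_complete[OF Z] unfolding complete_def by auto
  qed (auto simp: v_def)
  then obtain g where g: "\<And>x. x \<in> space M \<Longrightarrow> (\<lambda>k. v k x) \<longlonglongrightarrow> g x" by metis
  have gM: "g \<in> borel_measurable M" by (rule borel_measurable_LIMSEQ_metric[OF v g])
  \<comment> \<open>Fatou with \<open>m\<close> fixed: once \<open>k \<ge> m\<close>, also
    \<open>r k \<ge> m\<close>, so the Cauchy bound holds for \<open>u k\<close> and passes to the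
    limit \<open>g\<close>.\<close>
  have est: "(\<integral>\<^sup>+x. ennreal (dist (s m x) (g x) powr p) \<partial>M) \<le> ennreal (e powr p)"
    if "e > 0" and e: "\<And>n. n \<ge> m \<Longrightarrow> Lp_dist p M (s m) (s n) < e" for m e
  proof -
    have "(\<integral>\<^sup>+x. ennreal (dist (s m x) (g x) powr p) \<partial>M)
        = (\<integral>\<^sup>+x. liminf (\<lambda>k. ennreal (dist (s m x) (v k x) powr p)) \<partial>M)"
    proof (rule nn_integral_cong)
      fix x assume "x \<in> space M"
      then have "(\<lambda>k. ennreal (dist (s m x) (v k x) powr p))
          \<longlonglongrightarrow> ennreal (dist (s m x) (g x) powr p)"
        using p g by (intro tendsto_ennrealI tendsto_powr2 tendsto_dist tendsto_const) auto
      then show "ennreal (dist (s m x) (g x) powr p)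
          = liminf (\<lambda>k. ennreal (dist (s m x) (v k x) powr p))"
        by (intro lim_imp_Liminf[symmetric]) auto
    qed
    also have "\<dots> \<le> liminf (\<lambda>k. \<integral>\<^sup>+x. ennreal (dist (s m x) (v k x) powr p) \<partial>M)"
    proof (rule nn_integral_liminf)
      show "(\<lambda>x. ennreal (dist (s m x) (v k x) powr p)) \<in> borel_measurable M" for k
        using borel_measurable_dist_compact[OF Z, of "s m" M "v k"] by measurable
    qed
    also have "\<dots> \<le> ennreal (e powr p)"
    proof (rule Liminf_le)
      show "eventually (\<lambda>k. (\<integral>\<^sup>+x. ennreal (dist (s m x) (v k x) powr p) \<partial>M) \<le> ennreal (e powr p)) sequentially"
        using eventually_ge_at_top[of m]
      proof (rule eventually_mono)
        fix k assume "m \<le> k"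
        have "(\<integral>\<^sup>+x. ennreal (dist (s m x) (v k x) powr p) \<partial>M)
            = (\<integral>\<^sup>+x. ennreal (dist (s m x) (u k x) powr p) \<partial>M)"
          using AE_E by (intro nn_integral_cong_AE) (auto simp: v_def)
        also have "\<dots> = ennreal (Lp_dist p M (s m) (u k) powr p)"
          by (rule nn_integral_Lp_dist[OF p Y sL uL])
        also have "\<dots> \<le> ennreal (e powr p)"
          using e[of "r k"] rk[of k] \<open>m \<le> k\<close> p Lp_dist_nonneg
          by (intro ennreal_leI powr_mono2) (auto simp: u_def less_imp_le)
        finally show "(\<integral>\<^sup>+x. ennreal (dist (s m x) (v k x) powr p) \<partial>M) \<le> ennreal (e powr p)" .
      qed
    qed simp
    finally show ?thesis .
  qed
  obtain N1 where "\<And>n. n \<ge> N1 \<Longrightarrow> Lp_dist p M (s N1) (s n) < 1" using Cauchy[of 1] by auto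
  from est[OF _ this] have "(\<integral>\<^sup>+x. ennreal (dist (s N1 x) (g x) powr p) \<partial>M) < \<infinity>"
    by (simp add: le_less_trans)
  then have gL: "g \<in> Lp_maps p M y0" by (rule Lp_mapsI[OF p Y sL gM])
  have "(\<lambda>n. Lp_dist p M (s n) g) \<longlonglongrightarrow> 0"
  proof (rule LIMSEQ_I)
    fix e :: real assume "e > 0"
    then obtain N2 where N2: "\<And>m n. m \<ge> N2 \<Longrightarrow> n \<ge> N2 \<Longrightarrow> Lp_dist p M (s m) (s n) < e / 2"
      using Cauchy[of "e / 2"] by auto
    have "Lp_dist p M (s m) g \<le> e / 2" if "m \<ge> N2" for m
    proof -
      have "ennreal (Lp_dist p M (s m) g powr p) \<le> ennreal ((e / 2) powr p)"
        using est[of "e / 2" m] N2 that \<open>e > 0\<close> nn_integral_Lp_dist[OF p Y sL gL] by simp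
      then have "Lp_dist p M (s m) g powr p \<le> (e / 2) powr p" by simp
      then show ?thesis
        using p \<open>e > 0\<close> Lp_dist_nonneg powr_less_mono2[of p "e / 2" "Lp_dist p M (s m) g"] by force
    qed
    then have "norm (Lp_dist p M (s n) g - 0) < e" if "n \<ge> N2" for n
      using \<open>e > 0\<close> that Lp_dist_nonneg[of p M "s n" g] by fastforce
    then show "\<exists>no. \<forall>n\<ge>no. norm (Lp_dist p M (s n) g - 0) < e" by blast
  qed
  then show ?thesis using gL by blast
qed

lemma compact_covered_by_finite_balls:
  fixes K :: "'a::metric_space set"
  assumes "compact K" "r > 0"
  obtains k where "finite k" "K \<subseteq> (\<Union>x\<in>k. ball x r)"
  using assms compact_eq_totally_bounded[of K] by meson

section \<open>Haar measure on a proper space and the averaging argument\<close>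

text \<open>\<open>c\<close> discretises \<open>K\<close>. Its finite range makes every composite
  \<open>v (c x)\<close> a simple function, whatever the map \<open>v\<close>.\<close>

lemma simple_function_near_identity_on_compact:
  fixes K :: "'a::metric_space set"
  assumes M: "sets M = sets borel" and "compact K" "r > 0"
  obtains c where "simple_function M c" "\<And>x. x \<in> K \<Longrightarrow> dist x (c x) < r"
proof -
  obtain k where k: "finite k" "K \<subseteq> (\<Union>x\<in>k. ball x r)"
    using compact_covered_by_finite_balls assms(2,3) by metis
  have "\<exists>c. simple_function M c \<and> (\<forall>x\<in>\<Union>a\<in>k. ball a r. dist x (c x) < r)"
    using k(1)
  proof (induction k)
    case empty
    show ?case by (auto intro: simple_function_const[of M undefined])
  next
    case (insert a k)
    then obtain c where c: "simple_function M c" "\<forall>x\<in>\<Union>a\<in>k. ball a r. dist x (c x) < r" by blast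
    have "ball a r \<inter> space M \<in> sets M" using M sets_eq_imp_space_eq[OF M] by simp
    then have "simple_function M (\<lambda>x. if x \<in> ball a r then a else c x)"
      using c by (intro simple_function_If_set) auto
    then show ?case
      using c by (intro exI[of _ "\<lambda>x. if x \<in> ball a r then a else c x"]) (auto simp: dist_commute)
  qed
  then show ?thesis using that k(2) by blast
qed

context
  fixes M :: "'a::banach measure"
  assumes haar: "haar_measure M" and proper: "\<And>r. compact (cball (0::'a) r)"
begin

lemma haar_sets: "sets M = sets borel"
  using haar unfolding haar_measure_def by blast

lemma haar_space: "space M = UNIV"
  using sets_eq_imp_space_eq[OF haar_sets] by simp

lemma haar_measurable_eq: "measurable M N = measurable borel N"
  by (rule measurable_cong_sets[OF haar_sets refl])

lemma haar_emeasure_translate: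
  "A \<in> sets borel \<Longrightarrow> emeasure M ((\<lambda>x. h + x) ` A) = emeasure M A"
  using haar unfolding haar_measure_def by blast

lemma haar_emeasure_compact: "compact K \<Longrightarrow> emeasure M K < \<infinity>"
  using haar unfolding haar_measure_def by blast

lemma haar_emeasure_ball: "emeasure M (ball x r) = emeasure M (ball 0 r)"
proof -
  have "(\<lambda>y. x + y) ` ball 0 r = ball x r"
    using ball_translation[of x 0 r] by simp
  then show ?thesis using haar_emeasure_translate[of "ball 0 r" x] by simp
qed

lemma haar_emeasure_ball_finite: "emeasure M (ball x r) < \<infinity>"
proof -
  have "emeasure M (ball 0 r) \<le> emeasure M (cball 0 r)"
    by (intro emeasure_mono) (auto simp: haar_sets)
  then show ?thesis
    using haar_emeasure_compact[OF proper] haar_emeasure_ball by (metis le_less_trans)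
qed

lemma haar_emeasure_le_card_balls:
  assumes "finite k" "A \<subseteq> (\<Union>x\<in>k. ball x r)"
  shows "emeasure M A \<le> of_nat (card k) * emeasure M (ball 0 r)"
proof -
  have "emeasure M A \<le> emeasure M (\<Union>x\<in>k. ball x r)"
    using assms by (intro emeasure_mono) (auto simp: haar_sets)
  also have "\<dots> \<le> (\<Sum>x\<in>k. emeasure M (ball x r))"
    using assms by (intro emeasure_subadditive_finite) (auto simp: haar_sets)
  also have "\<dots> = of_nat (card k) * emeasure M (ball 0 r)"
    by (subst haar_emeasure_ball) simp
  finally show ?thesis .
qed

text \<open>If one ball were null, so would be all balls of that radius, then all compact sets by
  finite covers, and by inner regularity the whole space.\<close>

lemma haar_emeasure_ball_pos:
  assumes "r > 0"
  shows "emeasure M (ball x r) > 0"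
proof (rule ccontr)
  assume "\<not> ?thesis"
  then have 0: "emeasure M (ball 0 r) = 0" using haar_emeasure_ball[of x r] by simp
  have "emeasure M K = 0" if K: "compact K" for K
  proof -
    obtain k where "finite k" "K \<subseteq> (\<Union>x\<in>k. ball x r)"
      using compact_covered_by_finite_balls[OF K assms] .
    then show ?thesis using haar_emeasure_le_card_balls[of k K r] 0 by simp
  qed
  then have "(SUP K\<in>{K. compact K \<and> K \<subseteq> UNIV}. emeasure M K) \<le> 0"
    by (intro SUP_least) auto
  moreover have "emeasure M UNIV = (SUP K\<in>{K. compact K \<and> K \<subseteq> UNIV}. emeasure M K)"
    using haar open_UNIV unfolding haar_measure_def by blast
  moreover have "emeasure M UNIV \<noteq> 0"
    using haar unfolding haar_measure_def by blast
  ultimately show False by simp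
qed

text \<open>A cover of \<open>cball 0 2\<close> by unit balls, scaled by \<open>r\<close>, covers
  \<open>ball 0 (2 * r)\<close> by the same number of balls of radius \<open>r\<close>. Only
  translation invariance is then used, so \<open>N\<close> does not depend on
  \<open>r\<close>.\<close>

lemma haar_doubling:
  obtains N :: nat where "\<And>r. r > 0 \<Longrightarrow>
    emeasure M (ball 0 (2 * r)) \<le> of_nat N * emeasure M (ball 0 r)"
proof -
  obtain k where k: "finite k" "cball (0::'a) 2 \<subseteq> (\<Union>x\<in>k. ball x 1)"
    using compact_covered_by_finite_balls[OF proper[of 2], of 1] by auto
  have "emeasure M (ball 0 (2 * r)) \<le> of_nat (card k) * emeasure M (ball 0 r)" if "r > 0" for r
  proof -
    have "ball 0 (2 * r) \<subseteq> (\<Union>x\<in>(\<lambda>x. r *\<^sub>R x) ` k. ball x r)"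
    proof
      fix y :: 'a assume "y \<in> ball 0 (2 * r)"
      then have "(1 / r) *\<^sub>R y \<in> cball 0 2" using that by (simp add: field_simps)
      then obtain x where x: "x \<in> k" "dist x ((1 / r) *\<^sub>R y) < 1"
        using subsetD[OF k(2)] by (metis UN_E mem_ball)
      have "dist (r *\<^sub>R x) y = norm (r *\<^sub>R (x - (1 / r) *\<^sub>R y))"
        using that by (simp add: dist_norm scaleR_diff_right)
      also have "\<dots> = r * dist x ((1 / r) *\<^sub>R y)" using that by (simp add: dist_norm)
      also have "\<dots> < r" using x that by simp
      finally show "y \<in> (\<Union>x\<in>(\<lambda>x. r *\<^sub>R x) ` k. ball x r)" using x by auto
    qed
    then have "emeasure M (ball 0 (2 * r)) \<le> of_nat (card ((\<lambda>x. r *\<^sub>R x) ` k)) * emeasure M (ball 0 r)"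
      by (intro haar_emeasure_le_card_balls finite_imageI k)
    also have "\<dots> \<le> of_nat (card k) * emeasure M (ball 0 r)"
      using card_image_le[OF k(1)] by (intro mult_right_mono) auto
    finally show ?thesis .
  qed
  then show ?thesis by (rule that)
qed

lemma haar_separable: "\<exists>D :: 'a set. countable D \<and> closure D = UNIV"
proof (rule sigma_compact_imp_separable)
  show "compact (cball (0::'a) (real n))" for n by (rule proper)
  show "(\<Union>n. cball (0::'a) (real n)) = UNIV" using real_arch_simple by auto
qed

lemma haar_sigma_finite: "sigma_finite_measure M"
proof
  show "\<exists>A. countable A \<and> A \<subseteq> sets M \<and> \<Union> A = space M \<and> (\<forall>a\<in>A. emeasure M a \<noteq> \<infinity>)"
  proof (intro exI conjI)
    show "countable (range (\<lambda>n. cball (0::'a) (real n)))" by simp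
    show "range (\<lambda>n. cball (0::'a) (real n)) \<subseteq> sets M" by (auto simp: haar_sets)
    show "\<Union> (range (\<lambda>n. cball (0::'a) (real n))) = space M"
      using real_arch_simple by (auto simp: haar_space)
    show "\<forall>a\<in>range (\<lambda>n. cball (0::'a) (real n)). emeasure M a \<noteq> \<infinity>"
      using haar_emeasure_compact[OF proper] by (auto simp: less_top)
  qed
qed

lemma haar_measurable_translate: "(\<lambda>x. x + h) \<in> measurable M M"
proof -
  have "(\<lambda>x :: 'a. x + h) \<in> borel_measurable borel"
    by (intro borel_measurable_continuous_onI continuous_intros)
  then show ?thesis using haar_measurable_eq measurable_cong_sets[OF refl haar_sets] by metis
qed

lemma haar_distr_translate: "distr M M (\<lambda>x. x + h) = M"
proof (rule measure_eqI)
  fix A assume "A \<in> sets (distr M M (\<lambda>x. x + h))"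
  then have A: "A \<in> sets M" by simp
  have "(\<lambda>x. x + h) -` A = (\<lambda>x. - h + x) ` A"
  proof (intro equalityI subsetI)
    fix x assume "x \<in> (\<lambda>x. x + h) -` A"
    then show "x \<in> (\<lambda>x. - h + x) ` A" by (intro image_eqI[of _ _ "x + h"]) auto
  qed auto
  then show "emeasure (distr M M (\<lambda>x. x + h)) A = emeasure M A"
    using A haar_emeasure_translate[of A "- h"] haar_sets
    by (simp add: emeasure_distr[OF haar_measurable_translate] haar_space)
qed simp

lemma haar_nn_integral_translate:
  assumes "g \<in> borel_measurable M"
  shows "(\<integral>\<^sup>+x. g (x + h) \<partial>M) = (\<integral>\<^sup>+x. g x \<partial>M)"
  using nn_integral_distr[OF haar_measurable_translate, of g h] assms
  by (simp add: haar_distr_translate)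

lemma haar_measurable_add:
  assumes "f \<in> borel_measurable N" "g \<in> borel_measurable N"
  shows "(\<lambda>x. f x + g x :: 'a) \<in> borel_measurable N"
proof -
  obtain D :: "'a set" where D: "countable D" "closure D = UNIV" using haar_separable by blast
  have "continuous_on UNIV (\<lambda>z :: 'a \<times> 'a. fst z + snd z)" by (intro continuous_intros)
  from borel_measurable_continuous_Pair_separable[OF D D this assms] show ?thesis by simp
qed

text \<open>If every \<open>t\<close> failed, integrating over \<open>t\<close> in the ball of
  radius \<open>r\<close> and substituting \<open>h = c x + t - x\<close>, which has norm below
  \<open>2 * r\<close>, would give \<open>Suc N\<close> times a quantity at most \<open>N\<close>
  times itself.\<close>

lemma exists_good_translate:
  fixes \<phi> :: "'a \<times> 'a \<Rightarrow> ennreal" and \<eta> :: ennreal and N :: nat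
  assumes \<phi>: "\<phi> \<in> borel_measurable (borel \<Otimes>\<^sub>M borel)"
    and r: "r > 0" and K: "K \<in> sets borel"
    and c: "simple_function M c" "\<And>x. x \<in> K \<Longrightarrow> dist x (c x) < r"
    and \<eta>: "0 < \<eta>" "\<eta> < \<infinity>"
    and le: "\<And>h. h \<in> ball 0 (2 * r) \<Longrightarrow> (\<integral>\<^sup>+x. \<phi> (x, x + h) \<partial>M) \<le> \<eta>"
    and N: "emeasure M (ball 0 (2 * r)) \<le> of_nat N * emeasure M (ball 0 r)"
  shows "\<exists>t. (\<integral>\<^sup>+x. indicator K x * \<phi> (x, c x + t) \<partial>M) \<le> of_nat (Suc N) * \<eta>"
proof (rule ccontr)
  assume "\<not> ?thesis"
  then have gt: "of_nat (Suc N) * \<eta> \<le> (\<integral>\<^sup>+x. indicator K x * \<phi> (x, c x + t) \<partial>M)" for t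
    by (meson linear)
  interpret sigma_finite_measure M by (rule haar_sigma_finite)
  interpret pair_sigma_finite M M ..
  note [measurable] = \<phi> and [measurable_cong] = haar_sets
  have [measurable]: "K \<in> sets M" using K haar_sets by simp
  have [measurable]: "c \<in> borel_measurable M" by (rule borel_measurable_simple_function[OF c(1)])
  have add[measurable]: "(\<lambda>x. f x + g x :: 'a) \<in> borel_measurable L"
    if "f \<in> borel_measurable L" "g \<in> borel_measurable L" for f g and L :: "('a \<times> 'a) measure"
    by (rule haar_measurable_add[OF that])
  have add1[measurable]: "(\<lambda>x. f x + g x :: 'a) \<in> borel_measurable L"
    if "f \<in> borel_measurable L" "g \<in> borel_measurable L" for f g and L :: "'a measure"
    by (rule haar_measurable_add[OF that])
  have [measurable]: "(\<lambda>x. x) \<in> borel_measurable M" by (simp add: haar_measurable_eq)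
  let ?B = "ball (0 :: 'a) r" and ?B2 = "ball (0 :: 'a) (2 * r)"
  have [measurable]: "?B \<in> sets M" "?B2 \<in> sets M" by (auto simp: haar_sets)
  have "of_nat (Suc N) * \<eta> * emeasure M ?B = (\<integral>\<^sup>+t. of_nat (Suc N) * \<eta> * indicator ?B t \<partial>M)"
    by (simp add: nn_integral_cmult_indicator)
  also have "\<dots> \<le> (\<integral>\<^sup>+t. \<integral>\<^sup>+x. indicator ?B t * (indicator K x * \<phi> (x, c x + t)) \<partial>M \<partial>M)"
  proof (rule nn_integral_mono)
    fix t
    show "of_nat (Suc N) * \<eta> * indicator ?B t
        \<le> (\<integral>\<^sup>+x. indicator ?B t * (indicator K x * \<phi> (x, c x + t)) \<partial>M)"
      using gt[of t] by (simp split: split_indicator)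
  qed
  also have "\<dots> = (\<integral>\<^sup>+x. \<integral>\<^sup>+t. indicator ?B t * (indicator K x * \<phi> (x, c x + t)) \<partial>M \<partial>M)"
    by (rule Fubini') measurable
  also have "\<dots> \<le> (\<integral>\<^sup>+x. \<integral>\<^sup>+h. indicator ?B2 h * \<phi> (x, x + h) \<partial>M \<partial>M)"
  proof (rule nn_integral_mono)
    fix x
    show "(\<integral>\<^sup>+t. indicator ?B t * (indicator K x * \<phi> (x, c x + t)) \<partial>M)
        \<le> (\<integral>\<^sup>+h. indicator ?B2 h * \<phi> (x, x + h) \<partial>M)"
    proof (cases "x \<in> K")
      case True
      \<comment> \<open>For fixed \<open>x\<close> the shift \<open>c x - x\<close> is a constant of
        norm below \<open>r\<close>, so the ball of radius \<open>r\<close> moves into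
        \<open>?B2\<close> and translation invariance applies.\<close>
      have "(\<integral>\<^sup>+t. indicator ?B t * (indicator K x * \<phi> (x, c x + t)) \<partial>M)
          \<le> (\<integral>\<^sup>+t. indicator ?B2 (t + (c x - x)) * \<phi> (x, x + (t + (c x - x))) \<partial>M)"
      proof (rule nn_integral_mono)
        fix t
        have "t + (c x - x) \<in> ?B2" if "t \<in> ?B"
          using norm_triangle_ineq4[of t "x - c x"] that c(2)[OF True]
          by (simp add: dist_norm norm_minus_commute[of "x - c x" t])
        then show "indicator ?B t * (indicator K x * \<phi> (x, c x + t))
            \<le> indicator ?B2 (t + (c x - x)) * \<phi> (x, x + (t + (c x - x)))"
          using True by (auto simp: algebra_simps split: split_indicator)
      qed
      also have "\<dots> = (\<integral>\<^sup>+h. indicator ?B2 h * \<phi> (x, x + h) \<partial>M)"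
        by (rule haar_nn_integral_translate) measurable
      finally show ?thesis .
    qed simp
  qed
  also have "\<dots> = (\<integral>\<^sup>+h. \<integral>\<^sup>+x. indicator ?B2 h * \<phi> (x, x + h) \<partial>M \<partial>M)"
    by (rule Fubini'[symmetric]) measurable
  also have "\<dots> \<le> (\<integral>\<^sup>+h. \<eta> * indicator ?B2 h \<partial>M)"
  proof (rule nn_integral_mono)
    fix h
    show "(\<integral>\<^sup>+x. indicator ?B2 h * \<phi> (x, x + h) \<partial>M) \<le> \<eta> * indicator ?B2 h"
      using le[of h] by (simp split: split_indicator)
  qed
  also have "\<dots> = \<eta> * emeasure M ?B2" by (simp add: nn_integral_cmult_indicator)
  also have "\<dots> \<le> \<eta> * (of_nat N * emeasure M ?B)" by (intro mult_left_mono N) simp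
  finally have *: "of_nat (Suc N) * \<eta> * emeasure M ?B \<le> \<eta> * (of_nat N * emeasure M ?B)" .
  \<comment> \<open>Cancelling \<open>x\<close> requires it to be positive and finite; this is where
    positivity and finiteness of the measure of balls are needed.\<close>
  define x where "x = \<eta> * emeasure M ?B"
  have x: "0 < x" "x < \<infinity>"
    using \<eta> haar_emeasure_ball_pos[OF r] haar_emeasure_ball_finite
    by (auto simp: x_def ennreal_zero_less_mult_iff ennreal_mult_less_top)
  obtain y where y: "x = ennreal y" "y > 0" using x by (cases x) auto
  have "of_nat (Suc N) * x \<le> of_nat N * x" using * by (simp add: x_def ac_simps)
  then have "real (Suc N) * y \<le> real N * y"
    using y by (simp add: ennreal_of_nat_eq_real_of_nat ennreal_mult[symmetric] del: of_nat_Suc)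
  then show False using y by (simp add: algebra_simps)
qed

end

section \<open>Total boundedness of the family\<close>

lemma translate_in_Lp_maps:
  fixes f :: "'a::banach \<Rightarrow> ('b::metric_space, 'q::finite) unordered"
  assumes "haar_measure M" "\<And>r. compact (cball (0::'a) r)" and f: "f \<in> Lp_maps p M y0"
  shows "translate h f \<in> Lp_maps p M y0"
proof -
  have f': "f \<in> borel_measurable M"
    "integrable M (\<lambda>x. dist (f x) (unordered_const y0) powr p)"
    using f by (auto simp: Lp_maps_def)
  note T = haar_measurable_translate[OF assms(1,2), of h]
  have "integrable (distr M M (\<lambda>x. x + h)) (\<lambda>x. dist (f x) (unordered_const y0) powr p)"
    using f'(2) haar_distr_translate[OF assms(1,2), of h] by simp
  then have "integrable M (\<lambda>x. dist (f (x + h)) (unordered_const y0) powr p)"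
    by (rule integrable_distr[OF T])
  then show ?thesis
    using measurable_compose[OF T f'(1)] by (simp add: Lp_maps_def translate_def)
qed

lemma truncate_in_Lp_maps:
  fixes f :: "'a::topological_space \<Rightarrow> ('b::metric_space, 'q::finite) unordered"
  assumes K: "K \<in> sets M" and f: "f \<in> Lp_maps p M y0"
  shows "truncate_to y0 K f \<in> Lp_maps p M y0"
proof -
  have [measurable]: "f \<in> borel_measurable M"
    and int: "integrable M (\<lambda>x. dist (f x) (unordered_const y0) powr p)"
    using f by (auto simp: Lp_maps_def)
  note K[measurable]
  have "(\<lambda>x. dist (truncate_to y0 K f x) (unordered_const y0) powr p)
      = (\<lambda>x. indicator K x *\<^sub>R dist (f x) (unordered_const y0) powr p)"
    by (auto simp: truncate_to_def fun_eq_iff)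
  moreover have "integrable M (\<lambda>x. indicator K x *\<^sub>R dist (f x) (unordered_const y0) powr p)"
    by (rule integrable_mult_indicator[OF K int])
  moreover have "truncate_to y0 K f \<in> borel_measurable M"
    unfolding truncate_to_def by measurable
  ultimately show ?thesis by (simp add: Lp_maps_def)
qed

lemma SUP_ennreal_less_imp_less:
  assumes "(SUP f\<in>F. ennreal (u f)) < ennreal e" "f \<in> F" "0 \<le> u f"
  shows "u f < e"
proof -
  have "ennreal (u f) < ennreal e" using SUP_upper[OF assms(2)] assms(1) by (rule le_less_trans)
  then show ?thesis using assms(3) by (simp add: ennreal_less_iff)
qed

text \<open>The sets \<open>K\<close> and \<open>k\<close>, the radius \<open>r\<close> and the map
  \<open>c\<close> depend on \<open>e\<close> but not on the member of \<open>F\<close>; only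
  \<open>t\<close> varies with \<open>f\<close>. Hence one finite set of step functions serves the
  whole family.\<close>

lemma Kolmogorov_Riesz_totally_bounded:
  fixes p :: real
    and lam :: "'a::banach measure"
    and y0 :: "'b::metric_space"
    and F :: "('a \<Rightarrow> ('b, 'q::finite) unordered) set"
  assumes p: "1 \<le> p"
    and proper: "\<And>r. compact (cball (0::'a) r)"
    and haar: "haar_measure lam"
    and Y: "compact (UNIV :: 'b set)"
    and F: "F \<subseteq> Lp_maps p lam y0"
    and translates: "\<And>\<epsilon>::real. \<epsilon> > 0 \<Longrightarrow> \<exists>U. open U \<and> 0 \<in> U \<and>
           (\<forall>h\<in>U. (SUP f\<in>F. ennreal (Lp_dist p lam (translate h f) f)) < ennreal \<epsilon>)"
    and tight: "\<And>\<epsilon>::real. \<epsilon> > 0 \<Longrightarrow> \<exists>K. compact K \<and>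
           (SUP f\<in>F. ennreal (Lp_dist p lam f (truncate_to y0 K f))) < ennreal \<epsilon>"
    and e: "e > 0"
  shows "\<exists>S. finite S \<and> S \<subseteq> Lp_maps p lam y0 \<and> (\<forall>f\<in>F. \<exists>s\<in>S. Lp_dist p lam s f < e)"
proof -
  let ?c = "unordered_const y0 :: ('b, 'q) unordered"
  have Z: "compact (UNIV :: ('b, 'q) unordered set)" by (rule compact_UNIV_unordered[OF Y])
  note sets[measurable_cong] = haar_sets[OF haar proper]
  obtain N :: nat where N: "\<And>r. r > 0 \<Longrightarrow>
      emeasure lam (ball 0 (2 * r)) \<le> of_nat N * emeasure lam (ball 0 r)"
    using haar_doubling[OF haar proper] by blast
  \<comment> \<open>Errors are added as \<open>p\<close>-th powers: truncation, translation and
    rounding each take \<open>E / 4\<close>, and \<open>3 * E / 4 < E\<close>.\<close>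
  define E where "E = e powr p"
  have E: "E > 0" using e by (simp add: E_def)

  obtain K where K: "compact K"
    and "(SUP f\<in>F. ennreal (Lp_dist p lam f (truncate_to y0 K f))) < ennreal ((E / 4) powr (1 / p))"
    using tight[of "(E / 4) powr (1 / p)"] E by auto
  then have tail: "Lp_dist p lam f (truncate_to y0 K f) < (E / 4) powr (1 / p)" if "f \<in> F" for f
    using SUP_ennreal_less_imp_less[OF _ that] Lp_dist_nonneg by metis
  have K_borel: "K \<in> sets borel" using K by (simp add: borel_compact)
  then have [measurable]: "K \<in> sets lam" using sets by simp
  define \<kappa> where "\<kappa> = measure lam K"
  have \<kappa>: "emeasure lam K = ennreal \<kappa>" "\<kappa> \<ge> 0"
    using haar_emeasure_compact[OF haar proper K] by (auto simp: \<kappa>_def emeasure_eq_ennreal_measure)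

  \<comment> \<open>The factor \<open>Suc N\<close> is lost in the averaging and
    \<open>2 powr p\<close> in separating translation from rounding.\<close>
  define \<eta> where "\<eta> = E / (4 * 2 powr p * real (Suc N))"
  have \<eta>: "\<eta> > 0" "2 powr p * (real (Suc N) * \<eta>) = E / 4" using E by (auto simp: \<eta>_def)
  obtain U where U: "open U" "0 \<in> U"
    and small: "\<And>h. h \<in> U \<Longrightarrow>
      (SUP f\<in>F. ennreal (Lp_dist p lam (translate h f) f)) < ennreal (\<eta> powr (1 / p))"
    using translates[of "\<eta> powr (1 / p)"] \<eta> by auto
  obtain R where R: "R > 0" "ball 0 R \<subseteq> U" using U open_contains_ball by metis
  define r where "r = R / 2"
  have r: "r > 0" "ball 0 (2 * r) \<subseteq> U" using R by (auto simp: r_def)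
  obtain c where c: "simple_function lam c" "\<And>x. x \<in> K \<Longrightarrow> dist x (c x) < r"
    using simple_function_near_identity_on_compact[OF sets K r(1)] by blast

  \<comment> \<open>Rounding by \<open>\<delta>\<close> on \<open>K\<close> costs
    \<open>2 powr p * (\<delta> powr p * \<kappa>)\<close>. The denominator has
    \<open>\<kappa> + 1\<close> because \<open>K\<close> may be null.\<close>
  define \<delta> where "\<delta> = (E / (4 * 2 powr p * (\<kappa> + 1))) powr (1 / p)"
  have \<delta>: "\<delta> > 0" using E \<kappa> by (simp add: \<delta>_def)
  have "2 powr p * (\<delta> powr p * \<kappa>) = E / 4 * (\<kappa> / (\<kappa> + 1))"
    using E \<kappa> p by (simp add: \<delta>_def powr_powr)
  also have "\<dots> \<le> E / 4 * 1" using E \<kappa> by (intro mult_left_mono) auto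
  finally have \<delta>_le: "2 powr p * (\<delta> powr p * \<kappa>) \<le> E / 4" by simp
  obtain k where k: "finite k" "(UNIV :: ('b, 'q) unordered set) \<subseteq> (\<Union>z\<in>k. ball z \<delta>)"
    using compact_covered_by_finite_balls[OF Z \<delta>] .
  have "\<exists>y. y \<in> k \<and> dist y z < \<delta>" for z using subsetD[OF k(2) UNIV_I, of z] by auto
  then obtain \<nu> where \<nu>: "\<And>z. \<nu> z \<in> k" "\<And>z. dist (\<nu> z) z < \<delta>" by metis

  define S where "S = (\<lambda>v x. if x \<in> K then v (c x) else ?c) ` (PiE (range c) (\<lambda>_. k))"
  have "finite (range c)" using c(1) haar_space[OF haar proper] by (simp add: simple_function_def)
  then have "finite S" unfolding S_def by (rule finite_imageI[OF finite_PiE]) (rule k(1))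

  have approx: "\<exists>s\<in>S \<inter> Lp_maps p lam y0. Lp_dist p lam s f < e" if fF: "f \<in> F" for f
  proof -
    have f: "f \<in> Lp_maps p lam y0" using F fF by blast
    then have [measurable]: "f \<in> borel_measurable lam" by (simp add: Lp_maps_def)
    then have f_borel: "f \<in> borel_measurable borel" using haar_measurable_eq[OF haar proper] by blast
    define \<phi> where "\<phi> z = ennreal (dist (f (snd z)) (f (fst z)) powr p)" for z
    have "(\<lambda>z. dist (f (snd z)) (f (fst z))) \<in> borel_measurable (borel \<Otimes>\<^sub>M borel)"
      using f_borel by (intro borel_measurable_dist_compact Z) measurable
    then have \<phi>: "\<phi> \<in> borel_measurable (borel \<Otimes>\<^sub>M borel)" unfolding \<phi>_def by measurable
    have "(\<integral>\<^sup>+x. \<phi> (x, x + h) \<partial>lam) \<le> ennreal \<eta>" if "h \<in> ball 0 (2 * r)" for h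
    proof -
      have "Lp_dist p lam (translate h f) f < \<eta> powr (1 / p)"
        using small[of h] that r(2) fF Lp_dist_nonneg by (intro SUP_ennreal_less_imp_less[of _ F]) auto
      then have "Lp_dist p lam (translate h f) f powr p \<le> (\<eta> powr (1 / p)) powr p"
        using p Lp_dist_nonneg by (intro powr_mono2) auto
      then have "ennreal (Lp_dist p lam (translate h f) f powr p) \<le> ennreal \<eta>"
        using p \<eta> by (intro ennreal_leI) (simp add: powr_powr)
      then show ?thesis
        using nn_integral_Lp_dist[OF p Y translate_in_Lp_maps[OF haar proper f] f, of h]
        by (simp add: \<phi>_def translate_def)
    qed
    then obtain t where t: "(\<integral>\<^sup>+x. indicator K x * \<phi> (x, c x + t) \<partial>lam) \<le> of_nat (Suc N) * ennreal \<eta>"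
      using exists_good_translate[OF haar proper \<phi> r(1) K_borel c _ _ _ N[OF r(1)], of "ennreal \<eta>"] \<eta>
      by auto
    define s where "s x = (if x \<in> K then \<nu> (f (c x + t)) else ?c)" for x
    have "s \<in> S" unfolding S_def
      using \<nu> by (intro image_eqI[of _ _ "restrict (\<lambda>a. \<nu> (f (a + t))) (range c)"]) (auto simp: s_def)
    \<comment> \<open>\<open>\<nu>\<close> is an arbitrary choice of net points; measurability comes
      from \<open>c\<close> being simple.\<close>
    have "(\<lambda>x. \<nu> (f (c x + t))) \<in> borel_measurable lam"
      using borel_measurable_simple_function[OF simple_function_compose1[OF c(1), of "\<lambda>a. \<nu> (f (a + t))"]] .
    then have s_meas: "s \<in> borel_measurable lam" unfolding s_def by measurable
    let ?g = "truncate_to y0 K f"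
    have g: "?g \<in> Lp_maps p lam y0" by (intro truncate_in_Lp_maps f) measurable
    have [measurable]: "(\<lambda>x. dist (f x) (?g x)) \<in> borel_measurable lam"
      using f g by (intro borel_measurable_dist_compact Z) (auto simp: Lp_maps_def)
    have c_meas: "(\<lambda>x. f (c x + t)) \<in> borel_measurable lam"
      using borel_measurable_simple_function[OF simple_function_compose1[OF c(1), of "\<lambda>a. f (a + t)"]] .
    have [measurable]: "(\<lambda>x. \<phi> (x, c x + t)) \<in> borel_measurable lam"
      unfolding \<phi>_def fst_conv snd_conv
      using borel_measurable_dist_compact[OF Z c_meas, of f] by measurable
    \<comment> \<open>Off \<open>K\<close>, \<open>s\<close> agrees with the truncation, and the
      first term is the exact error. On \<open>K\<close> the first term vanishes, and the detour
      through \<open>f (c x + t)\<close> gives the other two.\<close>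
    let ?h = "\<lambda>x. ennreal (dist (f x) (?g x) powr p)
      + ennreal (2 powr p) * (indicator K x * \<phi> (x, c x + t) + ennreal (\<delta> powr p) * indicator K x)"
    have "ennreal (dist (f x) (s x) powr p) \<le> ?h x" for x
    proof (cases "x \<in> K")
      case True
      have "dist (f x) (s x) powr p \<le> (dist (f (c x + t)) (f x) + \<delta>) powr p"
        using p True \<nu>(2)[of "f (c x + t)"] dist_triangle3[of "f x" "s x" "f (c x + t)"]
        by (intro powr_mono2) (auto simp: s_def dist_commute)
      also have "\<dots> \<le> 2 powr p * (dist (f (c x + t)) (f x) powr p + \<delta> powr p)"
        using p \<delta> by (intro powr_add_le) auto
      finally have "ennreal (dist (f x) (s x) powr p)
          \<le> ennreal (2 powr p * (dist (f (c x + t)) (f x) powr p + \<delta> powr p))"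
        by (rule ennreal_leI)
      also have "\<dots> = ennreal (2 powr p) * (\<phi> (x, c x + t) + ennreal (\<delta> powr p))"
        by (simp add: \<phi>_def ennreal_mult ennreal_plus)
      also have "\<dots> \<le> ?h x" using True by simp
      finally show ?thesis .
    qed (simp add: s_def truncate_to_def)
    then have "(\<integral>\<^sup>+x. ennreal (dist (f x) (s x) powr p) \<partial>lam) \<le> (\<integral>\<^sup>+x. ?h x \<partial>lam)"
      by (intro nn_integral_mono)
    also have "\<dots> = (\<integral>\<^sup>+x. ennreal (dist (f x) (?g x) powr p) \<partial>lam)
        + ennreal (2 powr p) * ((\<integral>\<^sup>+x. indicator K x * \<phi> (x, c x + t) \<partial>lam)
          + ennreal (\<delta> powr p) * emeasure lam K)"
      by (simp add: nn_integral_add nn_integral_cmult)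
    also have "\<dots> \<le> ennreal (E / 4) + ennreal (2 powr p) * (ennreal (real (Suc N) * \<eta>)
          + ennreal (\<delta> powr p) * ennreal \<kappa>)"
    proof (intro add_mono mult_left_mono)
      have "Lp_dist p lam f ?g powr p \<le> ((E / 4) powr (1 / p)) powr p"
        using tail[OF fF] p Lp_dist_nonneg by (intro powr_mono2) auto
      then show "(\<integral>\<^sup>+x. ennreal (dist (f x) (?g x) powr p) \<partial>lam) \<le> ennreal (E / 4)"
        unfolding nn_integral_Lp_dist[OF p Y f g] using p E
        by (intro ennreal_leI) (simp add: powr_powr)
      show "(\<integral>\<^sup>+x. indicator K x * \<phi> (x, c x + t) \<partial>lam) \<le> ennreal (real (Suc N) * \<eta>)"
        using t \<eta> by (simp add: ennreal_mult ennreal_of_nat_eq_real_of_nat del: of_nat_Suc)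
    qed (use \<kappa> in auto)
    also have "\<dots> = ennreal (E / 4 + (2 powr p * (real (Suc N) * \<eta>) + 2 powr p * (\<delta> powr p * \<kappa>)))"
      using E \<eta>(1) \<kappa>(2)
      by (simp add: ennreal_mult[symmetric] ennreal_plus[symmetric] distrib_left del: of_nat_Suc ennreal_plus)
    also have "\<dots> \<le> ennreal (3 * E / 4)"
      using \<eta>(2) \<delta>_le by (intro ennreal_leI) linarith
    finally have le: "(\<integral>\<^sup>+x. ennreal (dist (f x) (s x) powr p) \<partial>lam) \<le> ennreal (3 * E / 4)" .
    then have "(\<integral>\<^sup>+x. ennreal (dist (f x) (s x) powr p) \<partial>lam) < \<infinity>"
      by (simp add: le_less_trans)
    then have sL: "s \<in> Lp_maps p lam y0" by (rule Lp_mapsI[OF p Y f s_meas])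
    have "Lp_dist p lam f s powr p \<le> 3 * E / 4"
      using le E unfolding nn_integral_Lp_dist[OF p Y f sL] by simp
    also have "\<dots> < e powr p" using E by (simp add: E_def)
    finally have "Lp_dist p lam f s < e"
      using p e powr_mono2[of p e "Lp_dist p lam f s"] by (intro linorder_not_le[THEN iffD1]) auto
    then show ?thesis using \<open>s \<in> S\<close> sL by (subst Lp_dist_commute) blast
  qed
  \<comment> \<open>Membership in L_p was shown just for the chosen approximants, hence the
    intersection.\<close>
  then show ?thesis using \<open>finite S\<close> by (intro exI[of _ "S \<inter> Lp_maps p lam y0"]) auto
qed

theorem theorem4p2p1:
  fixes p :: real
    and lam :: "'a::banach measure"
    and y0 :: "'b::metric_space"
    and F :: "('a \<Rightarrow> ('b, 'q::finite) unordered) set"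
  assumes "1 \<le> p"
    and "\<exists>B :: 'a set. finite B \<and> span B = UNIV"
    and "haar_measure lam"
    and "compact (UNIV :: 'b set)"
    and "F \<subseteq> Lp_maps p lam y0"
    and "(SUP f\<in>F. ennreal (Lp_norm p lam y0 f)) < \<infinity>"
    and "\<And>\<epsilon>::real. \<epsilon> > 0 \<Longrightarrow> \<exists>U. open U \<and> 0 \<in> U \<and>
           (\<forall>h\<in>U. (SUP f\<in>F. ennreal (Lp_dist p lam (translate h f) f)) < ennreal \<epsilon>)"
    and "\<And>\<epsilon>::real. \<epsilon> > 0 \<Longrightarrow> \<exists>K. compact K \<and>
           (SUP f\<in>F. ennreal (Lp_dist p lam f (truncate_to y0 K f))) < ennreal \<epsilon>"
  shows "relatively_compact_in (Lp_topology p lam y0) F"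
proof -
  obtain B :: "'a set" where B: "finite B" "span B = UNIV" using assms(2) by blast
  \<comment> \<open>Finite dimension is passed on to the argument as compactness of closed
    balls.\<close>
  have proper: "compact (cball (0::'a) r)" for r
    using finite_span_compact_cball[OF B(1), of r] B(2) by simp
  have "compactin (Lp_topology p lam y0) (Lp_topology p lam y0 closure_of F)"
  proof (rule compactin_closure_of_semimetric)
    show "\<exists>S. finite S \<and> S \<subseteq> Lp_maps p lam y0 \<and> (\<forall>f\<in>F. \<exists>s\<in>S. Lp_dist p lam s f < e)"
      if "e > 0" for e
      by (rule Kolmogorov_Riesz_totally_bounded[OF assms(1) proper assms(3-5,7,8) that])
    show "\<exists>g\<in>Lp_maps p lam y0. (\<lambda>n. Lp_dist p lam (s n) g) \<longlonglongrightarrow> 0"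
      if "range s \<subseteq> Lp_maps p lam y0"
        "\<And>e. e > 0 \<Longrightarrow> \<exists>N. \<forall>m\<ge>N. \<forall>n\<ge>N. Lp_dist p lam (s m) (s n) < e" for s
      by (rule Lp_complete[OF assms(1,4) that])
    show "openin (Lp_topology p lam y0) U \<longleftrightarrow> U \<subseteq> Lp_maps p lam y0 \<and>
        (\<forall>f\<in>U. \<exists>r>0. \<forall>g\<in>Lp_maps p lam y0. Lp_dist p lam f g < r \<longrightarrow> g \<in> U)" for U
      by (rule openin_Lp_topology)
    show "Lp_dist p lam f h \<le> Lp_dist p lam f g + Lp_dist p lam g h"
      if "f \<in> Lp_maps p lam y0" "g \<in> Lp_maps p lam y0" "h \<in> Lp_maps p lam y0" for f g h
      by (rule Lp_dist_triangle[OF assms(1,4) that])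
    show "Lp_dist p lam f f = 0" for f by (simp add: Lp_dist_def)
  qed (fact Lp_dist_nonneg Lp_dist_commute assms(5))+
  then show ?thesis
    using assms(5) by (simp add: relatively_compact_in_def topspace_Lp_topology)
qed

end
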